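(* Let $1\le d'<d$, let $\Sigma$ and $\Sigma'$ be two conjugate $d'$-dimensional subshifts, and let $\varphi:\mathbb{N}\to\mathbb{N}$ be non-decreasing. Then: (1) $\Sigma$ is $\varphi,d$-realizable by projective subaction of a subshift of finite type if and only if $\Sigma'$ is; (2) $\Sigma$ is $\varphi,d$-realizable by projective subaction of a sofic subshift if and only if $\Sigma'$ is.
   Context: Intervals $[a,b]$ are integer intervals. A subshift of $\mathcal{A}^{\mathbb{Z}^d}$ ($\mathcal{A}$ a finite alphabet) is a closed shift-invariant subset. A pattern is an element $p\in\mathcal{A}^{\mathbb{U}}$ with $\mathbb{U}\subset\mathbb{Z}^d$ finite; it appears in $x$ if $p=x_{\mathbf{i}+\mathbb{U}}$ for some $\mathbf{i}$. $\mathbf{T}_F$ is the set of configurations in which no pattern of $F$ appears. $\mathcal{L}(X)$ is the set of patterns appearing in elements of $X$. A morphism is a continuous shift-commuting map; it is given by a local rule $\pi(x)_{\mathbf{i}}=\overline{\pi}(x_{\mathbf{i}+\mathbb{U}})$ with a finite neighborhood $\mathbb{U}$. Two subshifts are conjugate if there is a bijective morphism between them. Let $F$ be a finite set of $d$-dimensional patterns over $\mathcal{A}$ and $\pi:\mathcal{A}^{\mathbb{Z}^d}\to\mathcal{B}^{\mathbb{Z}^d}$ a morphism. $\mathbf{SA}_{d'}$ restricts a configuration to $\mathbb{Z}^{d'}\times\{0\}^{d-d'}$, identified with $\mathbb{Z}^{d'}$. $\mathbf{T}_F^{n,d\to d'}$ is the set of $x\in\mathcal{A}^{\mathbb{Z}^{d'}\times[-n,n]^{d-d'}}$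 in which no pattern of $F$ appears (occurrences inside the strip); $\pi$ is applied to such $x$ via its local rule wherever the neighborhood fits in the strip. The speed of convergence $\varphi_{F,\pi,d\to d'}(k)$ is the least integer $n\geq1$, large enough that $\mathbf{SA}_{d'}\circ\pi$ is defined on $\mathbf{T}_F^{n,d\to d'}$, such that every $u\in\mathcal{B}^{[0,k-1]^{d'}}$ with $u\notin\mathcal{L}(\mathbf{SA}_{d'}(\pi(\mathbf{T}_F)))$ satisfies $u\notin\mathcal{L}(\mathbf{SA}_{d'}(\pi(\mathbf{T}_F^{n,d\to d'})))$. For $\varphi,\varphi':\mathbb{N}\to\mathbb{N}$ non-decreasing, $\varphi\prec\varphi'$ means there are $r,M\in\mathbb{N}$ with $\varphi(k)\le M\varphi'(k+r)$ for all $k$; $\varphi\sim\varphi'$ means $\varphi\prec\varphi'$ and $\varphi'\prec\varphi$. A $d'$-dimensional subshift $\Sigma$ is $\varphi,d$-realizable by projective subaction of an SFT if there is a finite set $F$ of $d$-dimensional patterns with $\mathbf{SA}_{d'}(\mathbf{T}_F)=\Sigma$ and $\varphi_{F,\mathrm{Id},d\to d'}\sim\varphi$. It is $\varphi,d$-realizable by projective subaction of a sofic if there are a finite set $F$ of $d$-dimensional patterns and a morphism $\pi$ with $\mathbf{SA}_{d'}(\pi(\mathbf{T}_F))=\Sigma$ and $\varphi_{F,\pi,d\to d'}\prec\varphi$. *)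

theory Defs
  imports "HOL-Analysis.Function_Topology" "HOL-Library.Function_Algebras"
begin

text \<open>
  A point of \<open>\<int>\<^sup>d\<close> is a function \<open>nat \<Rightarrow> int\<close> that vanishes from index \<open>d\<close> on, so that addition is
  the pointwise one and, for \<open>d' \<le> d\<close>, the set \<open>\<int>\<^sup>d\<^sup>' \<times> {0}\<^sup>d\<^sup>-\<^sup>d\<^sup>'\<close> and its identification with
  \<open>\<int>\<^sup>d\<^sup>'\<close> are literally \<open>lattice d'\<close>.
\<close>

type_synonym pos = "nat \<Rightarrow> int"

definition lattice :: "nat \<Rightarrow> pos set" where
  "lattice d = {v. \<forall>j\<ge>d. v j = 0}"

definition strip :: "nat \<Rightarrow> nat \<Rightarrow> nat \<Rightarrow> pos set" where
  "strip d d' n = {v \<in> lattice d. \<forall>j\<in>{d'..<d}. - int n \<le> v j \<and> v j \<le> int n}"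

definition cube :: "nat \<Rightarrow> nat \<Rightarrow> pos set" where
  "cube d k = {v \<in> lattice d. \<forall>j<d. 0 \<le> v j \<and> v j \<le> int k - 1}"

text \<open>
  A configuration on \<open>D\<close> over the alphabet \<open>A\<close> is an element of \<open>D \<rightarrow>\<^sub>E A\<close>; for \<open>D = lattice d\<close> these
  are the points of the following topological space.
\<close>

definition full_shift :: "nat \<Rightarrow> 'a set \<Rightarrow> (pos \<Rightarrow> 'a) topology" where
  "full_shift d A = product_topology (\<lambda>_. discrete_topology A) (lattice d)"

definition shift :: "nat \<Rightarrow> pos \<Rightarrow> (pos \<Rightarrow> 'a) \<Rightarrow> (pos \<Rightarrow> 'a)" where
  "shift d v x = (\<lambda>i\<in>lattice d. x (i + v))"

definition subshift :: "nat \<Rightarrow> 'a set \<Rightarrow> (pos \<Rightarrow> 'a) set \<Rightarrow> bool" where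
  "subshift d A X \<longleftrightarrow> finite A \<and> closedin (full_shift d A) X
     \<and> (\<forall>v\<in>lattice d. shift d v ` X \<subseteq> X)"

definition morphism ::
  "nat \<Rightarrow> 'a set \<Rightarrow> (pos \<Rightarrow> 'a) set \<Rightarrow> 'b set \<Rightarrow> (pos \<Rightarrow> 'b) set
   \<Rightarrow> ((pos \<Rightarrow> 'a) \<Rightarrow> (pos \<Rightarrow> 'b)) \<Rightarrow> bool" where
  "morphism d A X B Y f \<longleftrightarrow>
     continuous_map (subtopology (full_shift d A) X) (subtopology (full_shift d B) Y) f
     \<and> (\<forall>v\<in>lattice d. \<forall>x\<in>X. f (shift d v x) = shift d v (f x))"

definition conjugate ::
  "nat \<Rightarrow> 'a set \<Rightarrow> (pos \<Rightarrow> 'a) set \<Rightarrow> 'b set \<Rightarrow> (pos \<Rightarrow> 'b) set \<Rightarrow> bool" where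
  "conjugate d A X B Y \<longleftrightarrow> (\<exists>f. morphism d A X B Y f \<and> bij_betw f X Y)"

text \<open>A pattern with support \<open>U\<close> is a partial function with domain \<open>U\<close>.\<close>

type_synonym 'a pattern = "pos \<rightharpoonup> 'a"

definition patterns :: "nat \<Rightarrow> 'a set \<Rightarrow> 'a pattern set" where
  "patterns d A = {p. finite (dom p) \<and> dom p \<subseteq> lattice d \<and> ran p \<subseteq> A}"

definition occurs_at :: "pos set \<Rightarrow> (pos \<Rightarrow> 'a) \<Rightarrow> 'a pattern \<Rightarrow> pos \<Rightarrow> bool" where
  "occurs_at D x p i \<longleftrightarrow> (\<forall>u\<in>dom p. i + u \<in> D \<and> p u = Some (x (i + u)))"

definition avoiding :: "nat \<Rightarrow> pos set \<Rightarrow> 'a set \<Rightarrow> 'a pattern set \<Rightarrow> (pos \<Rightarrow> 'a) set" where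
  "avoiding d D A F = {x \<in> D \<rightarrow>\<^sub>E A. \<forall>p\<in>F. \<forall>i\<in>lattice d. \<not> occurs_at D x p i}"

definition SFT :: "nat \<Rightarrow> 'a set \<Rightarrow> 'a pattern set \<Rightarrow> (pos \<Rightarrow> 'a) set" where
  "SFT d A F = avoiding d (lattice d) A F"

definition SFT_strip ::
  "nat \<Rightarrow> nat \<Rightarrow> nat \<Rightarrow> 'a set \<Rightarrow> 'a pattern set \<Rightarrow> (pos \<Rightarrow> 'a) set" where
  "SFT_strip d d' n A F = avoiding d (strip d d' n) A F"

definition language :: "nat \<Rightarrow> (pos \<Rightarrow> 'a) set \<Rightarrow> 'a pattern set" where
  "language d X = {p. finite (dom p) \<and> dom p \<subseteq> lattice d
     \<and> (\<exists>x\<in>X. \<exists>i\<in>lattice d. occurs_at (lattice d) x p i)}"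

definition SA :: "nat \<Rightarrow> (pos \<Rightarrow> 'a) \<Rightarrow> (pos \<Rightarrow> 'a)" where
  "SA d' x = restrict x (lattice d')"

definition local_rule ::
  "nat \<Rightarrow> 'a set \<Rightarrow> ((pos \<Rightarrow> 'a) \<Rightarrow> (pos \<Rightarrow> 'b)) \<Rightarrow> pos set \<Rightarrow> ((pos \<Rightarrow> 'a) \<Rightarrow> 'b) \<Rightarrow> bool" where
  "local_rule d A \<pi> U \<rho> \<longleftrightarrow> finite U \<and> U \<subseteq> lattice d
     \<and> (\<forall>x \<in> lattice d \<rightarrow>\<^sub>E A. \<forall>i\<in>lattice d. \<pi> x i = \<rho> (\<lambda>u\<in>U. x (i + u)))"

definition apply_rule ::
  "nat \<Rightarrow> pos set \<Rightarrow> ((pos \<Rightarrow> 'a) \<Rightarrow> 'b) \<Rightarrow> pos set \<Rightarrow> (pos \<Rightarrow> 'a) \<Rightarrow> (pos \<Rightarrow> 'b)" where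
  "apply_rule d U \<rho> D x =
     (\<lambda>i\<in>{i \<in> lattice d. (+) i ` U \<subseteq> D}. \<rho> (\<lambda>u\<in>U. x (i + u)))"

text \<open>
  A morphism has many local rules.  On the strip any rule whose neighborhood fits may be used: the
  morphism is defined on the whole full shift, so two such rules agree on all configurations of
  the strip, and the speed below depends on the morphism only.
\<close>

definition rule_fits ::
  "nat \<Rightarrow> nat \<Rightarrow> nat \<Rightarrow> 'a set \<Rightarrow> ((pos \<Rightarrow> 'a) \<Rightarrow> (pos \<Rightarrow> 'b)) \<Rightarrow> pos set
   \<Rightarrow> ((pos \<Rightarrow> 'a) \<Rightarrow> 'b) \<Rightarrow> bool" where
  "rule_fits d d' n A \<pi> U \<rho> \<longleftrightarrow> local_rule d A \<pi> U \<rho>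
     \<and> (\<forall>i\<in>lattice d'. (+) i ` U \<subseteq> strip d d' n)"

definition SA_strip_image ::
  "nat \<Rightarrow> nat \<Rightarrow> nat \<Rightarrow> 'a set \<Rightarrow> 'a pattern set \<Rightarrow> ((pos \<Rightarrow> 'a) \<Rightarrow> (pos \<Rightarrow> 'b))
   \<Rightarrow> (pos \<Rightarrow> 'b) set" where
  "SA_strip_image d d' n A F \<pi> =
     {SA d' (apply_rule d U \<rho> (strip d d' n) x) | U \<rho> x.
        rule_fits d d' n A \<pi> U \<rho> \<and> x \<in> SFT_strip d d' n A F}"

text \<open>The minimum exists for finite \<open>A\<close>, \<open>B\<close>, \<open>F\<close> and a morphism \<open>\<pi>\<close>, by compactness.\<close>

definition speed ::
  "nat \<Rightarrow> nat \<Rightarrow> 'a set \<Rightarrow> 'b set \<Rightarrow> 'a pattern set \<Rightarrow> ((pos \<Rightarrow> 'a) \<Rightarrow> (pos \<Rightarrow> 'b))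
   \<Rightarrow> nat \<Rightarrow> nat" where
  "speed d d' A B F \<pi> k = (LEAST n. n \<ge> 1
     \<and> (\<exists>U \<rho>. rule_fits d d' n A \<pi> U \<rho>)
     \<and> (\<forall>u. dom u = cube d' k \<and> ran u \<subseteq> B
            \<and> u \<notin> language d' (SA d' ` \<pi> ` SFT d A F)
          \<longrightarrow> u \<notin> language d' (SA_strip_image d d' n A F \<pi>)))"

definition growth_le :: "(nat \<Rightarrow> nat) \<Rightarrow> (nat \<Rightarrow> nat) \<Rightarrow> bool" (infix \<open>\<prec>\<close> 50) where
  "\<phi> \<prec> \<psi> \<longleftrightarrow> (\<exists>r M. \<forall>k. \<phi> k \<le> M * \<psi> (k + r))"

definition growth_equiv :: "(nat \<Rightarrow> nat) \<Rightarrow> (nat \<Rightarrow> nat) \<Rightarrow> bool" (infix \<open>\<sim>\<close> 50) where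
  "\<phi> \<sim> \<psi> \<longleftrightarrow> \<phi> \<prec> \<psi> \<and> \<psi> \<prec> \<phi>"

definition realizable_SFT ::
  "(nat \<Rightarrow> nat) \<Rightarrow> nat \<Rightarrow> nat \<Rightarrow> 'a set \<Rightarrow> (pos \<Rightarrow> 'a) set \<Rightarrow> bool" where
  "realizable_SFT \<phi> d d' A \<Sigma> \<longleftrightarrow>
     (\<exists>F. finite F \<and> F \<subseteq> patterns d A \<and> SA d' ` SFT d A F = \<Sigma> \<and> speed d d' A A F id \<sim> \<phi>)"

text \<open>
  The alphabet \<open>C\<close> of the covering SFT is arbitrary; as HOL cannot quantify over types, it is taken
  among the finite sets of naturals, which up to renaming of letters are all finite alphabets.
\<close>

definition realizable_sofic ::
  "(nat \<Rightarrow> nat) \<Rightarrow> nat \<Rightarrow> nat \<Rightarrow> 'a set \<Rightarrow> (pos \<Rightarrow> 'a) set \<Rightarrow> bool" where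
  "realizable_sofic \<phi> d d' A \<Sigma> \<longleftrightarrow>
     (\<exists>(C :: nat set) F \<pi>. finite C \<and> finite F \<and> F \<subseteq> patterns d C
        \<and> morphism d C (topspace (full_shift d C)) A (topspace (full_shift d A)) \<pi>
        \<and> SA d' ` \<pi> ` SFT d C F = \<Sigma> \<and> speed d d' C A F \<pi> \<prec> \<phi>)"

end

theory Submission
  imports Defs "HOL-Analysis.T1_Spaces"
begin

text \<open>
  Let \<open>f\<close> be the conjugacy and \<open>g\<close> its inverse; both are block maps on \<open>\<int>\<^sup>d\<^sup>'\<close>, hence act slice by slice on
  \<open>d\<close>-dimensional configurations.  In the sofic case \<open>f\<close> is composed with the factor map: a window
  of size \<open>k\<close> of the new image is determined by a window of size \<open>k + r\<close> of the old one.  In the SFT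
  case \<open>F\<close> is replaced by patterns forcing \<open>g y\<close> to avoid \<open>F\<close> and \<open>f (g y) = y\<close>, whose SFT is
  \<open>f\<close> of the old one.  The same bound holds for the new speed; for the converse bound, let \<open>N\<close> be the
  old speed at a size exceeding the window of \<open>g \<circ> f\<close>: in a strip of width \<open>n + N\<close> all slices up to
  distance \<open>n\<close> satisfy \<open>g (f x) = x\<close>, so that the old speed is at most the new one, at a larger size,
  plus the constant \<open>N\<close>.  The case \<open>\<Sigma> = {}\<close>, where an alphabet may be empty, is separate: the speed is
  then bounded.

  Configurations on strips are represented by their extensions to \<open>\<int>\<^sup>d\<close>; only occurrences of patterns
  are restricted to the strip.
\<close>

section \<open>Block maps\<close>

lemma topspace_full_shift: "topspace (full_shift d A) = lattice d \<rightarrow>\<^sub>E A"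
  by (simp add: full_shift_def)

lemma zero_in_lattice [simp]: "0 \<in> lattice d"
  by (simp add: lattice_def)

lemma add_in_lattice [simp]: "i \<in> lattice d \<Longrightarrow> j \<in> lattice d \<Longrightarrow> i + j \<in> lattice d"
  by (simp add: lattice_def)

lemma uminus_in_lattice [simp]: "i \<in> lattice d \<Longrightarrow> - i \<in> lattice d"
  by (simp add: lattice_def)

lemma lattice_mono: "d' \<le> d \<Longrightarrow> i \<in> lattice d' \<Longrightarrow> i \<in> lattice d"
  by (auto simp: lattice_def)

lemma cube_subset_lattice: "v \<in> cube d k \<Longrightarrow> v \<in> lattice d"
  by (simp add: cube_def)

lemma zero_in_cube_1: "0 \<in> cube d 1"
  by (simp add: cube_def)

lemma finite_cube: "finite (cube d k)"
proof -
  have "cube d k \<subseteq> (\<lambda>f j. if j < d then f j else 0) ` ({..<d} \<rightarrow>\<^sub>E {0..int k - 1})"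
  proof
    fix v assume v: "v \<in> cube d k"
    have "v = (\<lambda>j. if j < d then restrict v {..<d} j else 0)"
      using v by (auto simp: cube_def lattice_def fun_eq_iff)
    moreover have "restrict v {..<d} \<in> {..<d} \<rightarrow>\<^sub>E {0..int k - 1}"
      using v by (auto simp: cube_def)
    ultimately show "v \<in> (\<lambda>f j. if j < d then f j else 0) ` ({..<d} \<rightarrow>\<^sub>E {0..int k - 1})"
      by (rule image_eqI)
  qed
  then show ?thesis
    by (rule finite_subset) (auto intro!: finite_imageI finite_PiE)
qed

lemma strip_subset_lattice: "i \<in> strip d d' n \<Longrightarrow> i \<in> lattice d"
  by (simp add: strip_def)

lemma lattice_subset_strip: "d' \<le> d \<Longrightarrow> i \<in> lattice d' \<Longrightarrow> i \<in> strip d d' n"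
  by (auto simp: strip_def lattice_def)

lemma strip_mono: "m \<le> n \<Longrightarrow> i \<in> strip d d' m \<Longrightarrow> i \<in> strip d d' n"
  by (force simp: strip_def)

lemma strip_add: "i \<in> strip d d' m \<Longrightarrow> j \<in> strip d d' n \<Longrightarrow> i + j \<in> strip d d' (m + n)"
  by (force simp: strip_def)

text \<open>A strip bounds only the coordinates from \<open>d'\<close> on, and a vector of
  \<open>lattice d'\<close> vanishes there. Hence every strip is invariant under translations along
  the slice.\<close>

lemma strip_add_lattice_iff:
  assumes "d' \<le> d" "u \<in> lattice d'"
  shows "i + u \<in> strip d d' n \<longleftrightarrow> i \<in> strip d d' n"
  using assms by (force simp: strip_def lattice_def)

lemma finite_subset_strip:
  assumes "finite W" "W \<subseteq> lattice d"
  obtains n where "1 \<le> n" "W \<subseteq> strip d d' n"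
proof
  \<comment> \<open>A crude bound that dominates every coordinate of every vector of
    \<open>W\<close> at once; \<open>Suc\<close> makes it positive.\<close>
  define n where "n = Suc (\<Sum>w\<in>W. \<Sum>j<d. nat \<bar>w j\<bar>)"
  show "1 \<le> n" by (simp add: n_def)
  show "W \<subseteq> strip d d' n"
  proof
    fix w assume w: "w \<in> W"
    have "- int n \<le> w j \<and> w j \<le> int n" if j: "j < d" for j
    proof -
      have "nat \<bar>w j\<bar> \<le> (\<Sum>j<d. nat \<bar>w j\<bar>)"
        by (rule member_le_sum) (use j in auto)
      also have "\<dots> \<le> (\<Sum>w\<in>W. \<Sum>j<d. nat \<bar>w j\<bar>)"
        by (rule member_le_sum[where f = "\<lambda>w. \<Sum>j<d. nat \<bar>w j\<bar>"]) (use w assms in auto)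
      finally have "nat \<bar>w j\<bar> \<le> n" by (simp add: n_def)
      then show ?thesis by linarith
    qed
    then show "w \<in> strip d d' n"
      using w assms by (auto simp: strip_def)
  qed
qed

text \<open>Cubes have a corner at the origin, so a window with negative coordinates must first be
  recentred by \<open>c\<close>. Both \<open>c\<close> and \<open>r\<close> depend on
  \<open>U\<close> alone and not on \<open>k\<close>; this is why \<open>r\<close> can later serve
  as the constant shift of the argument in \<open>\<prec>\<close>.\<close>

lemma cube_enlarge:
  assumes "finite U" "U \<subseteq> lattice d"
  obtains r c where "c \<in> lattice d" "\<And>k v u. v \<in> cube d k \<Longrightarrow> u \<in> U \<Longrightarrow> v + u + c \<in> cube d (k + r)"
proof -
  \<comment> \<open>For \<open>d' = 0\<close> the strip bounds all \<open>d\<close>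
    coordinates.\<close>
  obtain n where n: "U \<subseteq> strip d 0 n"
    using finite_subset_strip[OF assms] by blast
  define c where "c = (\<lambda>j. if j < d then int n else 0)"
  show thesis
  proof
    show "c \<in> lattice d" by (simp add: c_def lattice_def)
    fix k v u assume v: "v \<in> cube d k" and u: "u \<in> U"
    have "u \<in> strip d 0 n" using n u by blast
    then have "\<And>j. j < d \<Longrightarrow> - int n \<le> u j \<and> u j \<le> int n"
      by (auto simp: strip_def)
    with v show "v + u + c \<in> cube d (k + 2 * n)"
      using u assms by (force simp: cube_def c_def lattice_def)
  qed
qed

section \<open>Shifts and the topology of the full shift\<close>

lemma shift_apply: "i \<in> lattice d \<Longrightarrow> shift d v x i = x (i + v)"
  by (simp add: shift_def)

lemma shift_in_PiE:
  "x \<in> lattice d \<rightarrow>\<^sub>E A \<Longrightarrow> v \<in> lattice d \<Longrightarrow> shift d v x \<in> lattice d \<rightarrow>\<^sub>E A"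
  by (auto simp: shift_def)

lemma compact_space_full_shift: "finite A \<Longrightarrow> compact_space (full_shift d A)"
  by (simp add: full_shift_def compact_space_product_topology compact_space_discrete_topology)

lemma Hausdorff_space_full_shift: "Hausdorff_space (full_shift d A)"
  by (simp add: full_shift_def Hausdorff_space_product_topology)

text \<open>Cylinders over finite windows form a base of the product of discrete spaces. In this
  form the continuity and compactness arguments below only handle finite windows
  \<open>W\<close>.\<close>

lemma openin_full_shift_iff:
  "openin (full_shift d A) S \<longleftrightarrow> S \<subseteq> lattice d \<rightarrow>\<^sub>E A \<and>
     (\<forall>x\<in>S. \<exists>W. finite W \<and> W \<subseteq> lattice d \<and>
        (\<forall>y\<in>lattice d \<rightarrow>\<^sub>E A. (\<forall>w\<in>W. y w = x w) \<longrightarrow> y \<in> S))" (is "?L \<longleftrightarrow> ?R")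
proof
  assume L: ?L
  have "\<exists>W. finite W \<and> W \<subseteq> lattice d \<and>
        (\<forall>y\<in>lattice d \<rightarrow>\<^sub>E A. (\<forall>w\<in>W. y w = x w) \<longrightarrow> y \<in> S)" if "x \<in> S" for x
  proof -
    have "\<exists>U. finite {i \<in> lattice d. U i \<noteq> A} \<and>
        (\<forall>i\<in>lattice d. openin (discrete_topology A) (U i)) \<and> x \<in> Pi\<^sub>E (lattice d) U \<and> Pi\<^sub>E (lattice d) U \<subseteq> S"
      using L that unfolding full_shift_def openin_product_topology_alt topspace_discrete_topology by simp
    then obtain U where U: "finite {i \<in> lattice d. U i \<noteq> A}" "x \<in> Pi\<^sub>E (lattice d) U" "Pi\<^sub>E (lattice d) U \<subseteq> S"
      by (elim exE conjE)
    have "y \<in> S" if y: "y \<in> lattice d \<rightarrow>\<^sub>E A" and eq: "\<forall>w\<in>{i \<in> lattice d. U i \<noteq> A}. y w = x w" for y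
    proof -
      have "y i \<in> U i" if "i \<in> lattice d" for i
        using that y eq U(2) by (cases "U i = A") (auto simp: PiE_mem)
      then have "y \<in> Pi\<^sub>E (lattice d) U" using y by auto
      then show ?thesis using U(3) by blast
    qed
    then show ?thesis using U(1) by (intro exI[of _ "{i \<in> lattice d. U i \<noteq> A}"]) auto
  qed
  then show ?R
    using openin_subset[OF L] by (simp add: topspace_full_shift)
next
  assume R: ?R
  show ?L unfolding full_shift_def openin_product_topology_alt
  proof (intro ballI)
    fix x assume x: "x \<in> S"
    with R have "\<exists>W. finite W \<and> W \<subseteq> lattice d \<and>
        (\<forall>y\<in>lattice d \<rightarrow>\<^sub>E A. (\<forall>w\<in>W. y w = x w) \<longrightarrow> y \<in> S)" by simp
    then obtain W where W: "finite W" "W \<subseteq> lattice d"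
      "\<forall>y\<in>lattice d \<rightarrow>\<^sub>E A. (\<forall>w\<in>W. y w = x w) \<longrightarrow> y \<in> S" by (elim exE conjE)
    have xA: "x \<in> lattice d \<rightarrow>\<^sub>E A" using R x by blast
    \<comment> \<open>The product of these sets is the cylinder of \<open>x\<close> over
      \<open>W\<close>.\<close>
    define U where "U = (\<lambda>i. if i \<in> W then {x i} else A)"
    have "{i \<in> lattice d. U i \<noteq> topspace (discrete_topology A)} \<subseteq> W" by (auto simp: U_def)
    then have "finite {i \<in> lattice d. U i \<noteq> topspace (discrete_topology A)}"
      using W(1) finite_subset by blast
    moreover have "\<forall>i\<in>lattice d. openin (discrete_topology A) (U i)"
      using xA by (auto simp: U_def)
    moreover have "x \<in> Pi\<^sub>E (lattice d) U" using xA by (auto simp: U_def PiE_iff)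
    moreover have "Pi\<^sub>E (lattice d) U \<subseteq> S"
    proof
      fix y assume y: "y \<in> Pi\<^sub>E (lattice d) U"
      have "y i \<in> A" if "i \<in> lattice d" for i
        using PiE_mem[OF y that] PiE_mem[OF xA that] by (auto simp: U_def split: if_splits)
      then have "y \<in> lattice d \<rightarrow>\<^sub>E A" using y by (auto simp: PiE_iff)
      moreover have "y w = x w" if "w \<in> W" for w
        using PiE_mem[OF y, of w] subsetD[OF W(2) that] that by (simp add: U_def)
      ultimately show "y \<in> S" using W(3) by simp
    qed
    ultimately show "\<exists>U. finite {i \<in> lattice d. U i \<noteq> topspace (discrete_topology A)} \<and>
        (\<forall>i\<in>lattice d. openin (discrete_topology A) (U i)) \<and> x \<in> Pi\<^sub>E (lattice d) U \<and> Pi\<^sub>E (lattice d) U \<subseteq> S"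
      by (intro exI[of _ U]) simp
  qed
qed

lemma openin_full_shiftE:
  assumes "openin (full_shift d A) S" "x \<in> S"
  obtains W where "finite W" "W \<subseteq> lattice d"
    "\<And>y. y \<in> lattice d \<rightarrow>\<^sub>E A \<Longrightarrow> (\<And>w. w \<in> W \<Longrightarrow> y w = x w) \<Longrightarrow> y \<in> S"
proof -
  have "\<exists>W. finite W \<and> W \<subseteq> lattice d \<and>
      (\<forall>y\<in>lattice d \<rightarrow>\<^sub>E A. (\<forall>w\<in>W. y w = x w) \<longrightarrow> y \<in> S)"
    using assms unfolding openin_full_shift_iff by simp
  then show thesis using that by (elim exE conjE) simp
qed

section \<open>Subshifts, morphisms and conjugacies\<close>

lemma subshift_PiE: "subshift d A X \<Longrightarrow> x \<in> X \<Longrightarrow> x \<in> lattice d \<rightarrow>\<^sub>E A"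
  unfolding subshift_def by (metis closedin_subset subsetD topspace_full_shift)

lemma subshift_shift: "subshift d A X \<Longrightarrow> x \<in> X \<Longrightarrow> v \<in> lattice d \<Longrightarrow> shift d v x \<in> X"
  unfolding subshift_def by blast

lemma subshift_full_shift: "finite A \<Longrightarrow> subshift d A (topspace (full_shift d A))"
  unfolding subshift_def using shift_in_PiE[of _ d A]
  by (metis closedin_topspace image_subsetI topspace_full_shift)

lemma morphism_image:
  assumes "morphism d A X B Y f" "subshift d A X" "x \<in> X"
  shows "f x \<in> Y" "f x \<in> lattice d \<rightarrow>\<^sub>E B"
proof -
  have "x \<in> topspace (subtopology (full_shift d A) X)"
    using subshift_PiE[OF assms(2,3)] assms(3) by (simp add: topspace_full_shift)
  then have "f x \<in> topspace (subtopology (full_shift d B) Y)"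
    using assms(1) unfolding morphism_def continuous_map_def by blast
  then show "f x \<in> Y" "f x \<in> lattice d \<rightarrow>\<^sub>E B" by (auto simp: topspace_full_shift)
qed

lemma morphism_shift:
  "morphism d A X B Y f \<Longrightarrow> v \<in> lattice d \<Longrightarrow> x \<in> X \<Longrightarrow> f (shift d v x) = shift d v (f x)"
  by (simp add: morphism_def)

lemma morphism_comp:
  assumes "morphism d A X B Y f" "morphism d B Y C Z g" "subshift d A X"
  shows "morphism d A X C Z (g \<circ> f)"
  using assms morphism_image(1)[OF assms(1,3)] unfolding morphism_def
  by (auto intro: continuous_map_compose)

text \<open>A continuous bijection from a compact space onto a Hausdorff space is a homeomorphism,
  so the inverse is continuous; it commutes with shifts because \<open>f\<close> does and
  \<open>g\<close> inverts it on both sides.\<close>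

lemma conjugateE:
  assumes "subshift d A X" "subshift d B Y" "conjugate d A X B Y"
  obtains f g where "morphism d A X B Y f" "morphism d B Y A X g"
    "\<And>x. x \<in> X \<Longrightarrow> g (f x) = x" "\<And>y. y \<in> Y \<Longrightarrow> f (g y) = y"
proof -
  obtain f where f: "morphism d A X B Y f" "bij_betw f X Y"
    using assms(3) by (auto simp: conjugate_def)
  let ?X = "subtopology (full_shift d A) X" and ?Y = "subtopology (full_shift d B) Y"
  have tX: "topspace ?X = X" and tY: "topspace ?Y = Y"
    using subshift_PiE[OF assms(1)] subshift_PiE[OF assms(2)]
    by (auto simp: topspace_full_shift)
  have "compactin (full_shift d A) X"
    using assms(1) unfolding subshift_def
    by (blast intro: closedin_compact_space compact_space_full_shift)
  then have "compact_space ?X" by (simp add: compact_space_subtopology)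
  moreover have "Hausdorff_space ?Y" by (simp add: Hausdorff_space_full_shift Hausdorff_space_subtopology)
  moreover have "continuous_map ?X ?Y f" using f by (simp add: morphism_def)
  ultimately have "homeomorphic_map ?X ?Y f"
    using f(2) continuous_imp_homeomorphic_map[of ?X ?Y f]
    unfolding tX tY bij_betw_def by blast
  then obtain g where g: "homeomorphic_maps ?X ?Y f g"
    by (auto simp: homeomorphic_map_maps)
  then have cg: "continuous_map ?Y ?X g"
    and fg: "\<And>y. y \<in> Y \<Longrightarrow> f (g y) = y" and gf: "\<And>x. x \<in> X \<Longrightarrow> g (f x) = x"
    unfolding homeomorphic_maps_def tX tY by auto
  have gX: "\<And>y. y \<in> Y \<Longrightarrow> g y \<in> X"
    using cg unfolding continuous_map_def tX tY by auto
  have "g (shift d v y) = shift d v (g y)" if "v \<in> lattice d" "y \<in> Y" for v y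
    using that f(1) gX fg gf subshift_shift[OF assms(1)] morphism_shift[OF f(1)] by metis
  then have "morphism d B Y A X g" using cg by (simp add: morphism_def)
  then show thesis using that[OF f(1) _ gf fg] by simp
qed

lemma conjugate_sym:
  assumes "subshift d A X" "subshift d B Y" "conjugate d A X B Y"
  shows "conjugate d B Y A X"
proof -
  obtain f g where fg: "morphism d A X B Y f" "morphism d B Y A X g"
    "\<And>x. x \<in> X \<Longrightarrow> g (f x) = x" "\<And>y. y \<in> Y \<Longrightarrow> f (g y) = y"
    using conjugateE[OF assms] by blast
  have "bij_betw g Y X"
    by (rule bij_betw_byWitness[where f' = f])
      (use fg morphism_image(1)[OF fg(1) assms(1)] morphism_image(1)[OF fg(2) assms(2)] in auto)
  then show ?thesis using fg(2) by (auto simp: conjugate_def)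
qed

section \<open>Sliding block maps and their equality with morphisms\<close>

definition sliding ::
  "nat \<Rightarrow> pos set \<Rightarrow> ((pos \<Rightarrow> 'a) \<Rightarrow> 'b) \<Rightarrow> (pos \<Rightarrow> 'a) \<Rightarrow> (pos \<Rightarrow> 'b)" where
  "sliding d U \<rho> x = (\<lambda>i\<in>lattice d. \<rho> (\<lambda>u\<in>U. x (i + u)))"

lemma sliding_apply: "i \<in> lattice d \<Longrightarrow> sliding d U \<rho> x i = \<rho> (\<lambda>u\<in>U. x (i + u))"
  by (simp add: sliding_def)

lemma sliding_cong:
  assumes "i \<in> lattice d" "j \<in> lattice d" "\<And>u. u \<in> U \<Longrightarrow> x (i + u) = y (j + u)"
  shows "sliding d U \<rho> x i = sliding d U \<rho> y j"
  using assms by (simp add: sliding_def cong: restrict_cong)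

lemma sliding_in_PiE: "range \<rho> \<subseteq> B \<Longrightarrow> sliding d U \<rho> x \<in> lattice d \<rightarrow>\<^sub>E B"
  by (auto simp: sliding_def)

lemma sliding_shift:
  assumes "U \<subseteq> lattice d" "v \<in> lattice d"
  shows "sliding d U \<rho> (shift d v x) = shift d v (sliding d U \<rho> x)"
proof
  fix i
  show "sliding d U \<rho> (shift d v x) i = shift d v (sliding d U \<rho> x) i"
  proof (cases "i \<in> lattice d")
    case True
    have "sliding d U \<rho> (shift d v x) i = sliding d U \<rho> x (i + v)"
      by (rule sliding_cong) (use True assms in \<open>auto simp: shift_apply ac_simps\<close>)
    then show ?thesis using True by (simp add: shift_apply)
  qed (simp add: sliding_def shift_def)
qed

lemma morphism_sliding:
  assumes "finite U" "U \<subseteq> lattice d" "range \<rho> \<subseteq> B"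
  shows "morphism d A (topspace (full_shift d A)) B (topspace (full_shift d B)) (sliding d U \<rho>)"
proof -
  have "openin (full_shift d A) {x \<in> lattice d \<rightarrow>\<^sub>E A. sliding d U \<rho> x \<in> S}"
    if S: "openin (full_shift d B) S" for S
    unfolding openin_full_shift_iff
  proof (intro conjI ballI)
    fix x assume x: "x \<in> {x \<in> lattice d \<rightarrow>\<^sub>E A. sliding d U \<rho> x \<in> S}"
    then have "sliding d U \<rho> x \<in> S" by simp
    then obtain W where W: "finite W" "W \<subseteq> lattice d"
      "\<And>y. y \<in> lattice d \<rightarrow>\<^sub>E B \<Longrightarrow> (\<And>w. w \<in> W \<Longrightarrow> y w = sliding d U \<rho> x w) \<Longrightarrow> y \<in> S"
      using openin_full_shiftE[OF S] by metis
    \<comment> \<open>The image on \<open>W\<close> reads its argument only on \<open>W + U\<close>,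
      so the preimage of an open set contains a cylinder over this finite window.\<close>
    define V where "V = (\<lambda>(w, u). w + u) ` (W \<times> U)"
    have "sliding d U \<rho> y \<in> S" if "y\<in>lattice d \<rightarrow>\<^sub>E A" "\<forall>w\<in>V. y w = x w" for y
    proof (rule W(3))
      show "sliding d U \<rho> y w = sliding d U \<rho> x w" if "w \<in> W" for w
        using \<open>\<forall>w\<in>V. y w = x w\<close> that W(2) by (auto intro!: sliding_cong simp: V_def)
    qed (rule sliding_in_PiE[OF assms(3)])
    moreover have "finite V" "V \<subseteq> lattice d" using W(1,2) assms(1,2) by (auto simp: V_def subset_iff)
    ultimately show "\<exists>W. finite W \<and> W \<subseteq> lattice d \<and> (\<forall>y\<in>lattice d \<rightarrow>\<^sub>E A. (\<forall>w\<in>W. y w = x w) \<longrightarrow>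
        y \<in> {x \<in> lattice d \<rightarrow>\<^sub>E A. sliding d U \<rho> x \<in> S})" by blast
  qed auto
  then have "continuous_map (full_shift d A) (full_shift d B) (sliding d U \<rho>)"
    by (simp add: continuous_map_def topspace_full_shift sliding_in_PiE[OF assms(3)])
  then show ?thesis
    by (simp add: morphism_def sliding_shift[OF assms(2)])
qed

text \<open>The letter of \<open>f x\<close> at the origin is a locally constant function of
  \<open>x\<close>. By compactness finitely many cylinders cover \<open>X\<close>, and the union of
  their windows determines that letter; commutation with shifts carries the rule to all other
  positions.\<close>

theorem Curtis_Hedlund_Lyndon:
  assumes X: "subshift d A X" and f: "morphism d A X B Y f"
  obtains U \<rho> where "finite U" "U \<subseteq> lattice d" "0 \<in> U" "\<And>x. x \<in> X \<Longrightarrow> f x = sliding d U \<rho> x"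
proof -
  let ?X = "subtopology (full_shift d A) X" and ?Y = "subtopology (full_shift d B) Y"
  have XA: "\<And>x. x \<in> X \<Longrightarrow> x \<in> lattice d \<rightarrow>\<^sub>E A" using subshift_PiE[OF X] .
  have tX: "topspace ?X = X" using XA by (auto simp: topspace_full_shift)
  note fY = morphism_image[OF f X]
  have "\<exists>W. finite W \<and> W \<subseteq> lattice d \<and> (\<forall>y\<in>X. (\<forall>w\<in>W. y w = x w) \<longrightarrow> f y 0 = f x 0)"
    if x: "x \<in> X" for x
  proof -
    have "openin (full_shift d B) {y \<in> lattice d \<rightarrow>\<^sub>E B. y 0 = f x 0}"
      unfolding openin_full_shift_iff by (auto intro!: exI[of _ "{0}"])
    then have "openin ?Y (Y \<inter> {y \<in> lattice d \<rightarrow>\<^sub>E B. y 0 = f x 0})"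
      by (auto simp: openin_subtopology)
    then have "openin ?X {z \<in> topspace ?X. f z \<in> Y \<inter> {y \<in> lattice d \<rightarrow>\<^sub>E B. y 0 = f x 0}}"
      using f unfolding morphism_def continuous_map_def by blast
    then obtain T where T: "openin (full_shift d A) T"
      "{z \<in> X. f z \<in> Y \<inter> {y \<in> lattice d \<rightarrow>\<^sub>E B. y 0 = f x 0}} = T \<inter> X"
      unfolding tX openin_subtopology by blast
    have "x \<in> T" using T(2) x fY[OF x] by blast
    then obtain W where W: "finite W" "W \<subseteq> lattice d"
      "\<And>y. y \<in> lattice d \<rightarrow>\<^sub>E A \<Longrightarrow> (\<And>w. w \<in> W \<Longrightarrow> y w = x w) \<Longrightarrow> y \<in> T"
      using openin_full_shiftE[OF T(1)] by metis
    have "f y 0 = f x 0" if y: "y \<in> X" "\<forall>w\<in>W. y w = x w" for y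
    proof -
      have "y \<in> T \<inter> X" using W(3) XA y by simp
      then show ?thesis unfolding T(2)[symmetric] by simp
    qed
    then show ?thesis using W by (intro exI[of _ W]) simp
  qed
  then obtain W where W: "\<And>x. x \<in> X \<Longrightarrow> finite (W x)" "\<And>x. x \<in> X \<Longrightarrow> W x \<subseteq> lattice d"
    "\<And>x y. x \<in> X \<Longrightarrow> y \<in> X \<Longrightarrow> (\<forall>w\<in>W x. y w = x w) \<Longrightarrow> f y 0 = f x 0"
    by metis
  \<comment> \<open>The value of \<open>f\<close> at the origin is constant on the part of the
    cylinder \<open>Z x\<close> inside \<open>X\<close>.\<close>
  define Z where "Z = (\<lambda>x. {y \<in> lattice d \<rightarrow>\<^sub>E A. \<forall>w\<in>W x. y w = x w})"
  have "openin (full_shift d A) (Z x)" if "x \<in> X" for x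
    using W(1,2)[OF that] unfolding openin_full_shift_iff Z_def
    by (intro conjI ballI exI[of _ "W x"]) auto
  moreover have "compactin (full_shift d A) X"
    using X unfolding subshift_def by (blast intro: closedin_compact_space compact_space_full_shift)
  moreover have "X \<subseteq> \<Union> (Z ` X)" using XA by (auto simp: Z_def)
  ultimately have "\<exists>\<F>. finite \<F> \<and> \<F> \<subseteq> Z ` X \<and> X \<subseteq> \<Union> \<F>"
    by (intro compactinD) auto
  then obtain \<F> where "finite \<F>" "\<F> \<subseteq> Z ` X" and \<F>: "X \<subseteq> \<Union> \<F>"
    by (elim exE conjE)
  then obtain X0 where X0: "finite X0" "X0 \<subseteq> X" "\<F> = Z ` X0"
    using finite_subset_image[of \<F> Z X] by auto
  have cov: "\<exists>z\<in>X0. x \<in> Z z" if "x \<in> X" for x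
    using \<F> that unfolding X0(3) by auto
  \<comment> \<open>The origin is added because the recoding of forbidden patterns compares an image
    with the letter at the centre of the window.\<close>
  define U where "U = insert 0 (\<Union> (W ` X0))"
  have U: "finite U" "U \<subseteq> lattice d" "0 \<in> U" using X0 W(1,2) by (auto simp: U_def)
  \<comment> \<open>A cylinder \<open>Z z\<close> that contains \<open>x\<close> also contains
    \<open>y\<close>, as its window lies in \<open>U\<close>; both values then equal that of
    \<open>z\<close>.\<close>
  have det: "f x 0 = f y 0" if "x \<in> X" "y \<in> X" "\<And>u. u \<in> U \<Longrightarrow> x u = y u" for x y
  proof -
    obtain z where z: "z \<in> X0" "x \<in> Z z" using cov[OF \<open>x \<in> X\<close>] by auto
    then have x: "\<forall>w\<in>W z. x w = z w" by (simp add: Z_def)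
    moreover have "x w = y w" if "w \<in> W z" for w
      using \<open>\<And>u. u \<in> U \<Longrightarrow> x u = y u\<close>[of w] that z(1) by (auto simp: U_def)
    ultimately have y: "\<forall>w\<in>W z. y w = z w" by simp
    have "z \<in> X" using z(1) X0(2) by auto
    then show ?thesis using W(3)[of z x] W(3)[of z y] that(1,2) x y by simp
  qed
  \<comment> \<open>Any point of \<open>X\<close> showing the window \<open>w\<close> may be chosen,
    by \<open>det\<close>. On windows that do not occur in \<open>X\<close> at the origin the value
    is arbitrary.\<close>
  define \<rho> where "\<rho> = (\<lambda>w. f (SOME x. x \<in> X \<and> restrict x U = w) 0)"
  have \<rho>: "\<rho> (restrict x U) = f x 0" if x: "x \<in> X" for x
  proof -
    let ?y = "SOME y. y \<in> X \<and> restrict y U = restrict x U"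
    have y: "?y \<in> X \<and> restrict ?y U = restrict x U"
      by (rule someI[where x = x]) (use x in auto)
    have "?y u = x u" if "u \<in> U" for u
      using fun_cong[OF conjunct2[OF y], of u] that by simp
    then have "f ?y 0 = f x 0"
      using det[of ?y x] y x by blast
    then show ?thesis by (simp add: \<rho>_def)
  qed
  have "f x = sliding d U \<rho> x" if x: "x \<in> X" for x
  proof
    fix i
    show "f x i = sliding d U \<rho> x i"
    proof (cases "i \<in> lattice d")
      case True
      have "f x i = shift d i (f x) 0" by (simp add: shift_apply)
      also have "\<dots> = f (shift d i x) 0" using morphism_shift[OF f True x] by simp
      also have "\<dots> = \<rho> (restrict (shift d i x) U)"
        using \<rho> subshift_shift[OF X x True] by simp
      also have "restrict (shift d i x) U = (\<lambda>u\<in>U. x (i + u))"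
        using U(2) by (auto simp: shift_apply ac_simps intro!: restrict_ext)
      finally show ?thesis by (simp only: sliding_apply[OF True])
    next
      case False
      then show ?thesis using PiE_arb[OF fY(2)[OF x] False] by (simp add: sliding_def)
    qed
  qed
  then show thesis using that[OF U] by simp
qed

text \<open>The rule will be applied to strip configurations whose slices need not belong to
  \<open>X\<close>, so its values must be letters of \<open>B\<close> on every window. A fixed
  letter of the nonempty \<open>B\<close> replaces the stray values, which never arise on
  \<open>X\<close>.\<close>

corollary Curtis_Hedlund_Lyndon_total:
  assumes X: "subshift d A X" and f: "morphism d A X B Y f" and "B \<noteq> {}"
  obtains U \<rho> where "finite U" "U \<subseteq> lattice d" "0 \<in> U" "range \<rho> \<subseteq> B"
    "\<And>x. x \<in> X \<Longrightarrow> f x = sliding d U \<rho> x"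
proof -
  obtain U \<rho> where U: "finite U" "U \<subseteq> lattice d" "0 \<in> U" "\<And>x. x \<in> X \<Longrightarrow> f x = sliding d U \<rho> x"
    using Curtis_Hedlund_Lyndon[OF X f] by blast
  obtain b where b: "b \<in> B" using assms(3) by blast
  define \<sigma> where "\<sigma> = (\<lambda>w. if \<rho> w \<in> B then \<rho> w else b)"
  have "f x = sliding d U \<sigma> x" if x: "x \<in> X" for x
  proof
    fix i
    show "f x i = sliding d U \<sigma> x i"
    proof (cases "i \<in> lattice d")
      case True
      have "f x i \<in> B" using PiE_mem[OF morphism_image(2)[OF f X x] True] .
      moreover have "f x i = \<rho> (\<lambda>u\<in>U. x (i + u))"
        using sliding_apply[OF True] U(4)[OF x] by metis
      ultimately show ?thesis by (simp only: sliding_apply[OF True] \<sigma>_def if_True)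
    next
      case False
      then show ?thesis using U(4)[OF x] by (simp add: sliding_def)
    qed
  qed
  moreover have "range \<sigma> \<subseteq> B" using b by (auto simp: \<sigma>_def)
  ultimately show thesis using that U by blast
qed

section \<open>Speed of convergence\<close>

definition no_occurrence :: "nat \<Rightarrow> pos set \<Rightarrow> 'a set \<Rightarrow> 'a pattern set \<Rightarrow> (pos \<Rightarrow> 'a) set" where
  "no_occurrence d D A F =
     {x \<in> lattice d \<rightarrow>\<^sub>E A. \<forall>p\<in>F. \<forall>i\<in>lattice d. \<not> occurs_at D x p i}"

lemma SFT_eq_no_occurrence: "SFT d A F = no_occurrence d (lattice d) A F"
  by (simp add: SFT_def avoiding_def no_occurrence_def)

lemma no_occurrence_PiE: "x \<in> no_occurrence d D A F \<Longrightarrow> x \<in> lattice d \<rightarrow>\<^sub>E A"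
  by (simp add: no_occurrence_def)

lemma SFT_PiE: "x \<in> SFT d A F \<Longrightarrow> x \<in> lattice d \<rightarrow>\<^sub>E A"
  by (simp add: SFT_eq_no_occurrence no_occurrence_PiE)

lemma occurs_at_cong:
  "(\<And>i. i \<in> D \<Longrightarrow> x i = y i) \<Longrightarrow> occurs_at D x p i \<longleftrightarrow> occurs_at D y p i"
  unfolding occurs_at_def by (intro ball_cong refl) auto

lemma occurs_at_mono: "occurs_at D x p i \<Longrightarrow> D \<subseteq> E \<Longrightarrow> occurs_at E x p i"
  by (auto simp: occurs_at_def)

lemma no_occurrence_antimono: "D \<subseteq> E \<Longrightarrow> no_occurrence d E A F \<subseteq> no_occurrence d D A F"
  using occurs_at_mono unfolding no_occurrence_def by blast

lemma no_occurrence_cong: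
  assumes "y \<in> lattice d \<rightarrow>\<^sub>E A" "\<And>i. i \<in> D \<Longrightarrow> x i = y i"
    and "x \<in> no_occurrence d D A F"
  shows "y \<in> no_occurrence d D A F"
  using assms occurs_at_cong[of D x y] by (simp add: no_occurrence_def)

text \<open>An occurrence at \<open>i\<close> in the shifted configuration is one at
  \<open>i + j\<close> in \<open>x\<close>. With \<open>D = E\<close> this gives the invariance of
  strips along the slice and of the SFT; with a smaller \<open>D\<close> it recentres a strip at a
  slice away from the middle.\<close>

lemma no_occurrence_shift:
  assumes F: "F \<subseteq> patterns d A" and x: "x \<in> no_occurrence d E A F" and j: "j \<in> lattice d"
    and D: "D \<subseteq> lattice d" "\<And>i. i \<in> D \<Longrightarrow> i + j \<in> E"
  shows "shift d j x \<in> no_occurrence d D A F"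
proof -
  have "\<not> occurs_at D (shift d j x) p i" if p: "p \<in> F" and i: "i \<in> lattice d" for p i
  proof
    assume "occurs_at D (shift d j x) p i"
    then have "i + u + j \<in> E \<and> p u = Some (x (i + u + j))" if "u \<in> dom p" for u
      using D that by (simp only: occurs_at_def shift_apply subset_iff)
    then have "occurs_at E x p (i + j)"
      by (simp only: occurs_at_def ac_simps) blast
    then show False using x p i j by (simp add: no_occurrence_def)
  qed
  then show ?thesis
    using shift_in_PiE[OF no_occurrence_PiE[OF x] j] by (simp add: no_occurrence_def)
qed

lemma SFT_shift:
  assumes "F \<subseteq> patterns d A" "x \<in> SFT d A F" "j \<in> lattice d"
  shows "shift d j x \<in> SFT d A F"
  using assms no_occurrence_shift[of F d A x "lattice d" j "lattice d"]
  by (simp add: SFT_eq_no_occurrence)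

text \<open>Near \<open>lattice d'\<close> a fitting rule reads only inside the strip, so its result
  is the value of the morphism on any extension \<open>x\<close> of the strip configuration
  \<open>y\<close>. In particular the result does not depend on the rule chosen.\<close>

lemma rule_fits_apply:
  assumes "rule_fits d d' n A \<pi> U \<rho>" "d' \<le> d" "i \<in> lattice d'" "x \<in> lattice d \<rightarrow>\<^sub>E A"
    and "\<And>j. j \<in> strip d d' n \<Longrightarrow> x j = y j"
  shows "SA d' (apply_rule d U \<rho> (strip d d' n) y) i = \<pi> x i"
proof -
  have i: "i \<in> lattice d" using assms(2,3) lattice_mono by blast
  have U: "(+) i ` U \<subseteq> strip d d' n" using assms(1,3) by (simp add: rule_fits_def)
  then have "(\<lambda>u\<in>U. x (i + u)) = (\<lambda>u\<in>U. y (i + u))"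
    using assms(5) by (intro restrict_ext) auto
  moreover have "\<pi> x i = \<rho> (\<lambda>u\<in>U. x (i + u))"
    using assms(1,4) i by (simp only: rule_fits_def local_rule_def)
  ultimately show ?thesis
    using i U assms(3) by (simp only: SA_def apply_rule_def restrict_apply) simp
qed

lemma SA_strip_image_eq:
  assumes fit: "rule_fits d d' n A \<pi> U \<rho>" and d: "d' \<le> d"
  shows "SA_strip_image d d' n A F \<pi> = (\<lambda>x. SA d' (\<pi> x)) ` no_occurrence d (strip d d' n) A F"
    (is "?L = ?R")
proof
  let ?S = "strip d d' n"
  have eq: "SA d' (apply_rule d V \<sigma> ?S y) = SA d' (\<pi> x)"
    if "rule_fits d d' n A \<pi> V \<sigma>" "x \<in> lattice d \<rightarrow>\<^sub>E A" "\<And>j. j \<in> ?S \<Longrightarrow> x j = y j" for V \<sigma> x y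
    using rule_fits_apply[OF that(1) d _ that(2,3)] by (auto simp: SA_def fun_eq_iff)
  show "?L \<subseteq> ?R"
  proof
    fix z assume "z \<in> ?L"
    then obtain V \<sigma> y where y: "z = SA d' (apply_rule d V \<sigma> ?S y)" "rule_fits d d' n A \<pi> V \<sigma>"
      "y \<in> SFT_strip d d' n A F" by (auto simp: SA_strip_image_def)
    \<comment> \<open>The strip contains the origin, so \<open>y 0\<close> is a letter of
      \<open>A\<close> that can fill the outside. Only occurrences inside the strip count, hence the
      filling creates no forbidden one.\<close>
    define x where "x = (\<lambda>i\<in>lattice d. if i \<in> ?S then y i else y 0)"
    have yA: "y \<in> ?S \<rightarrow>\<^sub>E A" using y(3) by (simp add: SFT_strip_def avoiding_def)
    have S: "\<And>i. i \<in> ?S \<Longrightarrow> i \<in> lattice d" "0 \<in> ?S"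
      using strip_subset_lattice lattice_subset_strip[OF d, of 0] by auto
    have xA: "x \<in> lattice d \<rightarrow>\<^sub>E A" using yA S by (auto simp: x_def PiE_iff)
    have xy: "\<And>j. j \<in> ?S \<Longrightarrow> x j = y j" using S by (simp add: x_def)
    have "x \<in> no_occurrence d ?S A F"
      using y(3) xA occurs_at_cong[OF xy] by (simp add: SFT_strip_def avoiding_def no_occurrence_def)
    then show "z \<in> ?R" using y(1) eq[OF y(2) xA xy] by blast
  qed
  show "?R \<subseteq> ?L"
  proof
    fix z assume "z \<in> ?R"
    then obtain x where x: "z = SA d' (\<pi> x)" "x \<in> no_occurrence d ?S A F" by auto
    define y where "y = restrict x ?S"
    have xy: "\<And>j. j \<in> ?S \<Longrightarrow> x j = y j" by (simp add: y_def)
    have xA: "x \<in> lattice d \<rightarrow>\<^sub>E A" using x(2) by (rule no_occurrence_PiE)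
    have "y \<in> ?S \<rightarrow>\<^sub>E A"
      using xA strip_subset_lattice by (auto simp: y_def PiE_iff)
    then have "y \<in> SFT_strip d d' n A F"
      using x(2) occurs_at_cong[OF xy] by (simp add: SFT_strip_def avoiding_def no_occurrence_def)
    moreover have "z = SA d' (apply_rule d U \<rho> ?S y)" using eq[OF fit xA xy] x(1) by simp
    ultimately show "z \<in> ?L" unfolding SA_strip_image_def using fit by blast
  qed
qed

text \<open>The condition minimised in \<open>speed\<close>, with words and languages eliminated:
  instead of excluding words that the SFT does not produce, every strip configuration is matched on
  the cube by a point of the SFT.\<close>

definition adequate ::
  "nat \<Rightarrow> nat \<Rightarrow> 'a set \<Rightarrow> 'a pattern set \<Rightarrow> ((pos \<Rightarrow> 'a) \<Rightarrow> (pos \<Rightarrow> 'b)) \<Rightarrow> nat \<Rightarrow> nat \<Rightarrow> bool" where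
  "adequate d d' A F \<pi> k n \<longleftrightarrow> n \<ge> 1 \<and> (\<exists>U \<rho>. rule_fits d d' n A \<pi> U \<rho>) \<and>
     (\<forall>x\<in>no_occurrence d (strip d d' n) A F. \<exists>y\<in>SFT d A F. \<forall>v\<in>cube d' k. \<pi> x v = \<pi> y v)"

lemma SA_apply: "i \<in> lattice d' \<Longrightarrow> SA d' x i = x i"
  by (simp add: SA_def)

abbreviation full_morphism ::
  "nat \<Rightarrow> 'a set \<Rightarrow> 'b set \<Rightarrow> ((pos \<Rightarrow> 'a) \<Rightarrow> (pos \<Rightarrow> 'b)) \<Rightarrow> bool" where
  "full_morphism d A B \<pi> \<equiv>
     morphism d A (topspace (full_shift d A)) B (topspace (full_shift d B)) \<pi>"

lemma full_morphism_PiE: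
  assumes "full_morphism d A B \<pi>" "x \<in> lattice d \<rightarrow>\<^sub>E A"
  shows "\<pi> x \<in> lattice d \<rightarrow>\<^sub>E B"
  using assms unfolding morphism_def continuous_map_def by (auto simp: topspace_full_shift)

lemma full_morphism_shift:
  assumes "full_morphism d A B \<pi>" "x \<in> lattice d \<rightarrow>\<^sub>E A" "v \<in> lattice d" "i \<in> lattice d"
  shows "\<pi> (shift d v x) i = \<pi> x (i + v)"
  using morphism_shift[OF assms(1,3), of x] assms(2,4) by (simp add: topspace_full_shift shift_apply)

text \<open>A translation along \<open>lattice d'\<close> preserves \<open>D\<close> and moves any
  occurrence to the origin. Taking \<open>D\<close> as the whole lattice or as a strip covers both
  languages in the definition of \<open>speed\<close>.\<close>

lemma language_cube_iff:
  assumes \<pi>: "full_morphism d A B \<pi>" and F: "F \<subseteq> patterns d A" and d: "d' \<le> d"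
    and D: "D \<subseteq> lattice d" "\<And>i j. i \<in> D \<Longrightarrow> j \<in> lattice d' \<Longrightarrow> i + j \<in> D"
    and u: "dom u = cube d' k"
  shows "u \<in> language d' ((\<lambda>x. SA d' (\<pi> x)) ` no_occurrence d D A F) \<longleftrightarrow>
    (\<exists>x\<in>no_occurrence d D A F. \<forall>v\<in>cube d' k. u v = Some (\<pi> x v))" (is "?L \<longleftrightarrow> ?R")
proof
  assume ?L
  then obtain x i where x: "x \<in> no_occurrence d D A F" and i: "i \<in> lattice d'"
    and occ: "occurs_at (lattice d') (SA d' (\<pi> x)) u i" by (auto simp: language_def)
  have "shift d i x \<in> no_occurrence d D A F"
    using no_occurrence_shift[OF F x lattice_mono[OF d i] D(1)] D(2) i by blast
  moreover have "u v = Some (\<pi> (shift d i x) v)" if v: "v \<in> cube d' k" for v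
  proof -
    have vl: "v \<in> lattice d'" using v by (rule cube_subset_lattice)
    have "u v = Some (SA d' (\<pi> x) (i + v))" using occ v u by (simp add: occurs_at_def)
    also have "SA d' (\<pi> x) (i + v) = \<pi> (shift d i x) v"
      using full_morphism_shift[OF \<pi> no_occurrence_PiE[OF x], of i v] i vl lattice_mono[OF d]
      by (simp add: SA_apply add.commute)
    finally show ?thesis .
  qed
  ultimately show ?R by blast
next
  assume ?R
  then obtain x where x: "x \<in> no_occurrence d D A F"
    and eq: "\<And>v. v \<in> cube d' k \<Longrightarrow> u v = Some (\<pi> x v)" by blast
  have "occurs_at (lattice d') (SA d' (\<pi> x)) u 0"
    using eq u by (auto simp: occurs_at_def SA_apply cube_subset_lattice)
  moreover have "dom u \<subseteq> lattice d'" "finite (dom u)"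
    using u cube_subset_lattice finite_cube by auto
  ultimately show ?L
    unfolding language_def using x zero_in_lattice by blast
qed

lemma speed_eq_Least_adequate:
  fixes \<pi> :: "(pos \<Rightarrow> 'a) \<Rightarrow> (pos \<Rightarrow> 'b)"
  assumes \<pi>: "full_morphism d A B \<pi>" and F: "F \<subseteq> patterns d A" and d: "d' \<le> d"
  shows "speed d d' A B F \<pi> k = (LEAST n. adequate d d' A F \<pi> k n)"
proof -
  have "(\<forall>u. dom u = cube d' k \<and> ran u \<subseteq> B \<and> u \<notin> language d' (SA d' ` \<pi> ` SFT d A F)
          \<longrightarrow> u \<notin> language d' (SA_strip_image d d' n A F \<pi>)) \<longleftrightarrow>
     (\<forall>x\<in>no_occurrence d (strip d d' n) A F. \<exists>y\<in>SFT d A F. \<forall>v\<in>cube d' k. \<pi> x v = \<pi> y v)"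
    (is "?L \<longleftrightarrow> ?R") if "rule_fits d d' n A \<pi> U \<rho>" for n U \<rho>
  proof -
    have S: "strip d d' n \<subseteq> lattice d" "\<And>i j. i \<in> strip d d' n \<Longrightarrow> j \<in> lattice d' \<Longrightarrow> i + j \<in> strip d d' n"
      using strip_subset_lattice strip_add_lattice_iff[OF d] by blast+
    have 1: "u \<in> language d' (SA d' ` \<pi> ` SFT d A F) \<longleftrightarrow>
        (\<exists>x\<in>SFT d A F. \<forall>v\<in>cube d' k. u v = Some (\<pi> x v))" if "dom u = cube d' k" for u
      using language_cube_iff[OF \<pi> F d order.refl _ that] lattice_mono[OF d]
      by (simp add: SFT_eq_no_occurrence image_image)
    have 2: "u \<in> language d' (SA_strip_image d d' n A F \<pi>) \<longleftrightarrow>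
        (\<exists>x\<in>no_occurrence d (strip d d' n) A F. \<forall>v\<in>cube d' k. u v = Some (\<pi> x v))"
      if "dom u = cube d' k" for u
      using language_cube_iff[OF \<pi> F d S that] SA_strip_image_eq[OF \<open>rule_fits d d' n A \<pi> U \<rho>\<close> d] by simp
    show ?thesis
    proof
      assume L: ?L
      show ?R
      proof
        fix x assume x: "x \<in> no_occurrence d (strip d d' n) A F"
        \<comment> \<open>The word that \<open>\<pi> x\<close> shows on the cube. It lies in the
          language of the strip, so the condition on words puts it in that of the SFT, which yields
          the matching point.\<close>
        define u where "u = (\<lambda>v. if v \<in> cube d' k then Some (\<pi> x v) else None)"
        have du: "dom u = cube d' k" by (auto simp: u_def split: if_splits)
        have "\<pi> x v \<in> B" if "v \<in> cube d' k" for v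
          using PiE_mem[OF full_morphism_PiE[OF \<pi> no_occurrence_PiE[OF x]]]
            lattice_mono[OF d cube_subset_lattice[OF that]] .
        then have "ran u \<subseteq> B" by (auto simp: u_def ran_def split: if_splits)
        moreover have "u \<in> language d' (SA_strip_image d d' n A F \<pi>)"
          unfolding 2[OF du] using x by (auto simp: u_def)
        ultimately have "\<exists>y\<in>SFT d A F. \<forall>v\<in>cube d' k. u v = Some (\<pi> y v)"
          using L 1[OF du] du by blast
        then show "\<exists>y\<in>SFT d A F. \<forall>v\<in>cube d' k. \<pi> x v = \<pi> y v"
          by (simp add: u_def)
      qed
    next
      assume R: ?R
      show ?L
      proof (intro allI impI notI; elim conjE)
        fix u assume du: "dom u = cube d' k" and n: "u \<notin> language d' (SA d' ` \<pi> ` SFT d A F)"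
          and "u \<in> language d' (SA_strip_image d d' n A F \<pi>)"
        then obtain x where "x \<in> no_occurrence d (strip d d' n) A F" "\<forall>v\<in>cube d' k. u v = Some (\<pi> x v)"
          unfolding 2[OF du] by blast
        with R have "\<exists>y\<in>SFT d A F. \<forall>v\<in>cube d' k. u v = Some (\<pi> y v)" by fastforce
        then show False using n 1[OF du] by blast
      qed
    qed
  qed
  then have "(n \<ge> 1 \<and> (\<exists>U \<rho>. rule_fits d d' n A \<pi> U \<rho>) \<and> (\<forall>u. dom u = cube d' k \<and> ran u \<subseteq> B
            \<and> u \<notin> language d' (SA d' ` \<pi> ` SFT d A F)
          \<longrightarrow> u \<notin> language d' (SA_strip_image d d' n A F \<pi>))) = adequate d d' A F \<pi> k n" for n
    unfolding adequate_def by (intro conj_cong refl) (elim exE)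
  then show ?thesis unfolding speed_def by simp
qed

section \<open>Existence of adequate widths and basic bounds on the speed\<close>

lemma full_morphism_local_rule:
  assumes \<pi>: "full_morphism d A B \<pi>" and A: "finite A"
  obtains U \<rho> where "local_rule d A \<pi> U \<rho>"
proof -
  obtain U \<rho> where U: "finite U" "U \<subseteq> lattice d" "\<And>x. x \<in> lattice d \<rightarrow>\<^sub>E A \<Longrightarrow> \<pi> x = sliding d U \<rho> x"
    using Curtis_Hedlund_Lyndon[OF subshift_full_shift[OF A] \<pi>] unfolding topspace_full_shift by metis
  have "local_rule d A \<pi> U \<rho>"
    unfolding local_rule_def using U(1,2) by (auto simp only: U(3) sliding_apply)
  then show thesis by (rule that)
qed

text \<open>By compactness, configurations avoiding \<open>F\<close> on larger and larger strips accumulate at a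
  point of the SFT.\<close>

lemma ex_adequate:
  assumes \<pi>: "full_morphism d A B \<pi>" and A: "finite A" and F: "F \<subseteq> patterns d A" and d: "d' \<le> d"
  shows "\<exists>n. adequate d d' A F \<pi> k n"
proof (rule ccontr)
  assume none: "\<nexists>n. adequate d d' A F \<pi> k n"
  obtain U \<rho> where rule: "local_rule d A \<pi> U \<rho>" by (rule full_morphism_local_rule[OF \<pi> A])
  then have U: "finite U" "U \<subseteq> lattice d" 
    and U\<rho>: "\<And>x i. x \<in> lattice d \<rightarrow>\<^sub>E A \<Longrightarrow> i \<in> lattice d \<Longrightarrow> \<pi> x i = \<rho> (\<lambda>u\<in>U. x (i + u))"
    by (auto simp only: local_rule_def)
  obtain n0 where n0: "1 \<le> n0" "U \<subseteq> strip d d' n0"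
    using finite_subset_strip[OF U] by blast
  \<comment> \<open>The configurations that refute adequacy of the width \<open>n0 + n\<close>. The
    offset \<open>n0\<close> makes the neighborhood fit, so each \<open>K n\<close> is nonempty when
    no width is adequate.\<close>
  define K where "K = (\<lambda>n. {x \<in> no_occurrence d (strip d d' (n0 + n)) A F.
     \<not> (\<exists>y\<in>SFT d A F. \<forall>v\<in>cube d' k. \<pi> x v = \<pi> y v)})"
  have fits: "rule_fits d d' (n0 + n) A \<pi> U \<rho>" for n
  proof -
    have "i + u \<in> strip d d' (n0 + n)" if "i \<in> lattice d'" "u \<in> U" for i u
    proof -
      have "u \<in> strip d d' (n0 + n)" using n0(2) that(2) strip_mono[of n0 "n0 + n"] by auto
      then show ?thesis using strip_add_lattice_iff[OF d that(1), of u] by (simp add: add.commute)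
    qed
    then show ?thesis using rule by (auto simp: rule_fits_def)
  qed
  have "K n \<noteq> {}" for n
  proof
    assume "K n = {}"
    then have "adequate d d' A F \<pi> k (n0 + n)"
      unfolding adequate_def K_def using n0(1) fits[of n] by auto
    then show False using none by blast
  qed
  moreover have "closedin (full_shift d A) (K n)" for n
  proof -
    let ?S = "strip d d' (n0 + n)"
    \<comment> \<open>Being outside \<open>K n\<close> is visible on a finite window. Either a
      matching SFT point exists, and it matches whatever agrees with \<open>x\<close> on the cube
      plus \<open>U\<close>, or a forbidden pattern occurs in \<open>x\<close>, and it persists
      while its support is unchanged.\<close>
    have "\<exists>W. finite W \<and> W \<subseteq> lattice d \<and> (\<forall>y\<in>lattice d \<rightarrow>\<^sub>E A. (\<forall>w\<in>W. y w = x w) \<longrightarrow> y \<notin> K n)"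
      if x: "x \<in> lattice d \<rightarrow>\<^sub>E A" "x \<notin> K n" for x
    proof (cases "x \<in> no_occurrence d ?S A F")
      case True
      then obtain z where z: "z \<in> SFT d A F" "\<And>v. v \<in> cube d' k \<Longrightarrow> \<pi> x v = \<pi> z v"
        using x by (auto simp: K_def)
      define W where "W = (\<lambda>(v, u). v + u) ` (cube d' k \<times> U)"
      have cl: "v \<in> lattice d" if "v \<in> cube d' k" for v
        using lattice_mono[OF d cube_subset_lattice[OF that]] .
      have "y \<notin> K n" if y: "y \<in> lattice d \<rightarrow>\<^sub>E A" "\<forall>w\<in>W. y w = x w" for y
      proof -
        have "\<pi> y v = \<pi> z v" if v: "v \<in> cube d' k" for v
        proof -
          have "(\<lambda>u\<in>U. y (v + u)) = (\<lambda>u\<in>U. x (v + u))"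
            using y(2) v by (intro restrict_ext) (auto simp: W_def)
          then have "\<pi> y v = \<pi> x v" by (simp only: U\<rho>[OF y(1) cl[OF v]] U\<rho>[OF x(1) cl[OF v]])
          then show ?thesis using z(2)[OF v] by simp
        qed
        then show ?thesis using z(1) by (auto simp: K_def)
      qed
      moreover have "finite W" "W \<subseteq> lattice d"
        using U cl finite_cube by (auto simp: W_def subset_iff)
      ultimately show ?thesis by (intro exI[of _ W]) simp
    next
      case False
      then obtain p i where p: "p \<in> F" "i \<in> lattice d" "occurs_at ?S x p i"
        using x by (auto simp: no_occurrence_def)
      have dp: "finite (dom p)" "dom p \<subseteq> lattice d" using F p(1) by (auto simp: patterns_def)
      have "y \<notin> K n" if "\<forall>w\<in>(+) i ` dom p. y w = x w" for y
      proof -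
        have "occurs_at ?S y p i" using p(3) that by (simp add: occurs_at_def)
        then show ?thesis using p(1,2) by (auto simp: K_def no_occurrence_def)
      qed
      moreover have "finite ((+) i ` dom p)" "(+) i ` dom p \<subseteq> lattice d"
        using dp p(2) by (auto simp: subset_iff)
      ultimately show ?thesis by (intro exI[of _ "(+) i ` dom p"]) simp
    qed
    then have "openin (full_shift d A) (topspace (full_shift d A) - K n)"
      unfolding openin_full_shift_iff topspace_full_shift by simp
    moreover have "K n \<subseteq> topspace (full_shift d A)"
      by (simp add: K_def no_occurrence_def topspace_full_shift subset_iff)
    ultimately show ?thesis by (simp add: closedin_def)
  qed
  moreover have "decseq K"
  proof (rule antimonoI)
    fix m n :: nat assume "m \<le> n"
    then have "strip d d' (n0 + m) \<subseteq> strip d d' (n0 + n)"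
      using strip_mono[of "n0 + m" "n0 + n"] by auto
    from no_occurrence_antimono[OF this, of d A F] show "K n \<subseteq> K m"
      by (simp add: K_def subset_iff)
  qed
  ultimately have "(\<Inter>n. K n) \<noteq> {}"
    using compact_space_imp_nest[OF compact_space_full_shift[OF A], of d K] by simp
  then obtain x where x: "\<And>n. x \<in> K n" by blast
  \<comment> \<open>A forbidden occurrence would have finite support, hence lie in one of the
    strips. Once \<open>x\<close> is in the SFT it matches itself, contradicting its membership in
    \<open>K 0\<close>.\<close>
  have "x \<in> SFT d A F"
    unfolding SFT_eq_no_occurrence no_occurrence_def
  proof (intro CollectI conjI ballI notI)
    show "x \<in> lattice d \<rightarrow>\<^sub>E A" using x[of 0] by (simp add: K_def no_occurrence_def)
    fix p i assume p: "p \<in> F" "i \<in> lattice d" "occurs_at (lattice d) x p i"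
    have "finite (dom p)" "dom p \<subseteq> lattice d" using F p(1) by (auto simp: patterns_def)
    then have "finite ((+) i ` dom p)" "(+) i ` dom p \<subseteq> lattice d" using p(2) by auto
    then obtain n where "(+) i ` dom p \<subseteq> strip d d' n" using finite_subset_strip by metis
    then have "(+) i ` dom p \<subseteq> strip d d' (n0 + n)" using strip_mono[of n "n0 + n"] by auto
    then have "occurs_at (strip d d' (n0 + n)) x p i"
      using p(3) by (auto simp: occurs_at_def)
    then show False using x[of n] p(1,2) by (auto simp: K_def no_occurrence_def)
  qed
  then show False using x[of 0] by (auto simp: K_def)
qed

text \<open>Existence of some adequate width turns the \<open>LEAST\<close> into an actual minimum.
  With \<open>speed_le\<close>, comparing two speeds reduces to transferring adequacy from one
  system to the other.\<close>

lemma adequate_speed: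
  assumes "full_morphism d A B \<pi>" "finite A" "F \<subseteq> patterns d A" "d' \<le> d"
  shows "adequate d d' A F \<pi> k (speed d d' A B F \<pi> k)"
  using ex_adequate[OF assms, of k] speed_eq_Least_adequate[OF assms(1,3,4), of k]
  by (metis LeastI)

lemma speed_le:
  assumes "full_morphism d A B \<pi>" "F \<subseteq> patterns d A" "d' \<le> d" "adequate d d' A F \<pi> k n"
  shows "speed d d' A B F \<pi> k \<le> n"
  unfolding speed_eq_Least_adequate[OF assms(1-3)] by (rule Least_le) (rule assms(4))

lemma speed_ge_1:
  assumes "full_morphism d A B \<pi>" "finite A" "F \<subseteq> patterns d A" "d' \<le> d"
  shows "1 \<le> speed d d' A B F \<pi> k"
  using adequate_speed[OF assms] by (simp add: adequate_def)

text \<open>Adequacy at size \<open>k + r\<close> gives agreement on the cube of size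
  \<open>k\<close> thickened by \<open>W\<close>: translating by \<open>- c\<close> moves the
  comparison into the larger cube, and the matching point is translated back by \<open>c\<close>.
  The number \<open>r\<close> is uniform in \<open>k\<close> and \<open>n\<close>.\<close>

lemma adequate_window:
  assumes \<pi>: "full_morphism d A B \<pi>" and F: "F \<subseteq> patterns d A" and d: "d' \<le> d"
    and W: "finite W" "W \<subseteq> lattice d'"
  shows "\<exists>r. \<forall>k n. adequate d d' A F \<pi> (k + r) n \<longrightarrow>
    (\<forall>x\<in>no_occurrence d (strip d d' n) A F.
      \<exists>y\<in>SFT d A F. \<forall>v\<in>cube d' k. \<forall>w\<in>W. \<pi> x (v + w) = \<pi> y (v + w))"
proof -
  obtain r c where c: "c \<in> lattice d'"
    "\<And>k v w. v \<in> cube d' k \<Longrightarrow> w \<in> W \<Longrightarrow> v + w + c \<in> cube d' (k + r)"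
    using cube_enlarge[OF W] by metis
  have cl: "c \<in> lattice d" using lattice_mono[OF d c(1)] .
  show ?thesis
  proof (intro exI allI impI ballI)
    fix k n x assume n: "adequate d d' A F \<pi> (k + r) n"
      and x: "x \<in> no_occurrence d (strip d d' n) A F"
    \<comment> \<open>As \<open>c\<close> lies in \<open>lattice d'\<close>, the translation does
      not leave the strip and costs no width.\<close>
    have "shift d (- c) x \<in> no_occurrence d (strip d d' n) A F"
    proof (rule no_occurrence_shift[OF F x])
      show "i + - c \<in> strip d d' n" if "i \<in> strip d d' n" for i
        using that strip_add_lattice_iff[OF d, of "- c" i n] c(1) by simp
    qed (use cl strip_subset_lattice in auto)
    then obtain y where y: "y \<in> SFT d A F" "\<And>v. v \<in> cube d' (k + r) \<Longrightarrow> \<pi> (shift d (- c) x) v = \<pi> y v"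
      using n unfolding adequate_def by blast
    have "\<pi> x (v + w) = \<pi> (shift d c y) (v + w)" if v: "v \<in> cube d' k" and w: "w \<in> W" for v w
    proof -
      have l: "v + w + c \<in> lattice d'" "v + w \<in> lattice d'"
        using v w W(2) c(1) cube_subset_lattice by auto
      then have l: "v + w + c \<in> lattice d" "v + w \<in> lattice d"
        using lattice_mono[OF d] by blast+
      have "\<pi> x (v + w) = \<pi> (shift d (- c) x) (v + w + c)"
        using full_morphism_shift[OF \<pi> no_occurrence_PiE[OF x], of "- c" "v + w + c"] cl l by simp
      also have "\<dots> = \<pi> y (v + w + c)" using y(2) c(2) v w by blast
      also have "\<dots> = \<pi> (shift d c y) (v + w)"
        using full_morphism_shift[OF \<pi> SFT_PiE[OF y(1)] cl l(2)] by simp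
      finally show ?thesis .
    qed
    then show "\<exists>y\<in>SFT d A F. \<forall>v\<in>cube d' k. \<forall>w\<in>W. \<pi> x (v + w) = \<pi> y (v + w)"
      using SFT_shift[OF F y(1) cl] by blast
  qed
qed

section \<open>Transport along a conjugacy\<close>

no_notation Equipollence.lesspoll (infixl "\<prec>" 50)

lemma growth_leI: "(\<And>k. \<phi> k \<le> M * \<psi> (k + r)) \<Longrightarrow> \<phi> \<prec> \<psi>"
  unfolding growth_le_def by blast

lemma growth_le_trans:
  assumes "\<phi> \<prec> \<psi>" "\<psi> \<prec> \<chi>"
  shows "\<phi> \<prec> \<chi>"
proof -
  obtain r M where 1: "\<And>k. \<phi> k \<le> M * \<psi> (k + r)" using assms(1) by (auto simp: growth_le_def)
  obtain s N where 2: "\<And>k. \<psi> k \<le> N * \<chi> (k + s)" using assms(2) by (auto simp: growth_le_def)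
  have "\<phi> k \<le> (M * N) * \<chi> (k + (r + s))" for k
    using order.trans[OF 1[of k] mult_le_mono2[OF 2[of "k + r"], of M]] by (simp add: ac_simps)
  then show ?thesis by (rule growth_leI)
qed

lemma growth_equiv_trans: "\<phi> \<sim> \<psi> \<Longrightarrow> \<psi> \<sim> \<chi> \<Longrightarrow> \<phi> \<sim> \<chi>"
  unfolding growth_equiv_def using growth_le_trans by blast

lemma full_morphism_id: "full_morphism d A A id"
  by (simp add: morphism_def)

lemma rule_fits_id: "d' \<le> d \<Longrightarrow> rule_fits d d' n A id {0} (\<lambda>z. z 0)"
  by (simp add: rule_fits_def local_rule_def lattice_subset_strip)

section \<open>Block maps acting on slices and the recoding of forbidden patterns\<close>

lemma SA_sliding:
  assumes "U \<subseteq> lattice d'" "d' \<le> d"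
  shows "SA d' (sliding d U \<rho> x) = sliding d' U \<rho> (SA d' x)"
proof
  fix i
  show "SA d' (sliding d U \<rho> x) i = sliding d' U \<rho> (SA d' x) i"
  proof (cases "i \<in> lattice d'")
    case True
    then have "(\<lambda>u\<in>U. x (i + u)) = (\<lambda>u\<in>U. SA d' x (i + u))"
      using assms(1) by (intro restrict_ext) (auto simp: SA_apply subset_iff)
    then show ?thesis
      by (simp only: SA_apply[OF True] sliding_apply[OF True] sliding_apply[OF lattice_mono[OF assms(2) True]])
  qed (simp add: SA_def sliding_def)
qed

text \<open>The first family consists of the windows that the rule \<open>\<gamma>\<close> turns
  into a pattern of \<open>F\<close>; the second of the windows whose central letter is not
  recovered by \<open>\<gamma>\<close> followed by \<open>\<rho>\<close>. All positions read by the
  rules lie in the support, so \<open>the\<close> is harmless there; for \<open>q 0\<close> this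
  uses that the origin belongs to \<open>U\<close> and \<open>V\<close>.\<close>

definition recoded_patterns ::
  "pos set \<Rightarrow> ((pos \<Rightarrow> 'a) \<Rightarrow> 'b) \<Rightarrow> pos set \<Rightarrow> ((pos \<Rightarrow> 'b) \<Rightarrow> 'a) \<Rightarrow> 'b set \<Rightarrow> 'a pattern set \<Rightarrow> 'b pattern set" where
  "recoded_patterns U \<rho> V \<gamma> B F =
     (\<Union>p\<in>F. {q. dom q = (\<lambda>(u, v). u + v) ` (dom p \<times> V) \<and> ran q \<subseteq> B \<and>
        (\<forall>u\<in>dom p. p u = Some (\<gamma> (\<lambda>v\<in>V. the (q (u + v)))))}) \<union>
     {q. dom q = (\<lambda>(u, v). u + v) ` (U \<times> V) \<and> ran q \<subseteq> B \<and>
        the (q 0) \<noteq> \<rho> (\<lambda>u\<in>U. \<gamma> (\<lambda>v\<in>V. the (q (u + v))))}"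

lemma finite_recoded_patterns:
  assumes "finite U" "finite V" "finite B" "finite F" "F \<subseteq> patterns d A"
  shows "finite (recoded_patterns U \<rho> V \<gamma> B F)"
proof -
  have "finite {q. dom q = W \<and> ran q \<subseteq> B \<and> P q}" if "finite W" for W and P :: "'a pattern \<Rightarrow> bool"
    by (rule finite_subset[OF _ finite_set_of_finite_maps[OF that assms(3)]]) auto
  moreover have "finite (dom p)" if "p \<in> F" for p
    using assms(5) that by (auto simp: patterns_def)
  ultimately show ?thesis
    using assms unfolding recoded_patterns_def by simp
qed

lemma recoded_patterns_subset:
  assumes "finite U" "finite V" "U \<subseteq> lattice d" "V \<subseteq> lattice d" "F \<subseteq> patterns d A"
  shows "recoded_patterns U \<rho> V \<gamma> B F \<subseteq> patterns d B"
proof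
  fix q assume "q \<in> recoded_patterns U \<rho> V \<gamma> B F"
  then have "\<exists>W. finite W \<and> W \<subseteq> lattice d \<and> dom q = (\<lambda>(u, v). u + v) ` (W \<times> V)" and q: "ran q \<subseteq> B"
    using assms(1,3,5) unfolding recoded_patterns_def patterns_def by auto
  then obtain W where W: "finite W" "W \<subseteq> lattice d" "dom q = (\<lambda>(u, v). u + v) ` (W \<times> V)"
    by (elim exE conjE)
  have "finite (dom q)" using W assms(2) by simp
  moreover have "dom q \<subseteq> lattice d" unfolding W(3) using W(2) assms(4) by (auto simp: subset_iff)
  ultimately show "q \<in> patterns d B" using q by (simp add: patterns_def)
qed

lemma occurs_atD:
  "occurs_at D x p i \<Longrightarrow> u \<in> dom p \<Longrightarrow> i + u \<in> D"
  "occurs_at D x p i \<Longrightarrow> u \<in> dom p \<Longrightarrow> p u = Some (x (i + u))"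
  by (simp_all add: occurs_at_def)

text \<open>Both block maps only look in the directions of \<open>\<int>\<^sup>d\<^sup>'\<close>, so no width is lost on strips.\<close>

lemma no_occurrence_recoded_iff:
  assumes U: "U \<subseteq> lattice d'" "0 \<in> U" and V: "V \<subseteq> lattice d'" "0 \<in> V"
    and \<gamma>: "range \<gamma> \<subseteq> A" and F: "F \<subseteq> patterns d A" and d: "d' \<le> d"
    and D: "D \<subseteq> lattice d" "\<And>i u. i \<in> D \<Longrightarrow> u \<in> lattice d' \<Longrightarrow> i + u \<in> D"
    and y: "y \<in> lattice d \<rightarrow>\<^sub>E B"
  shows "y \<in> no_occurrence d D B (recoded_patterns U \<rho> V \<gamma> B F) \<longleftrightarrow>
    sliding d V \<gamma> y \<in> no_occurrence d D A F \<and>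
    (\<forall>i\<in>D. sliding d U \<rho> (sliding d V \<gamma> y) i = y i)" (is "?L \<longleftrightarrow> ?R1 \<and> ?R2")
proof -
  let ?g = "sliding d V \<gamma> y"
  let ?W = "\<lambda>W. (\<lambda>(u, v). u + v) ` (W \<times> V)"
  let ?P1 = "\<lambda>p. {q. dom q = ?W (dom p) \<and> ran q \<subseteq> B \<and>
        (\<forall>u\<in>dom p. p u = Some (\<gamma> (\<lambda>v\<in>V. the (q (u + v)))))}"
  let ?P2 = "{q. dom q = ?W U \<and> ran q \<subseteq> B \<and>
        the (q 0) \<noteq> \<rho> (\<lambda>u\<in>U. \<gamma> (\<lambda>v\<in>V. the (q (u + v))))}"
  have Ud: "U \<subseteq> lattice d" and Vd: "V \<subseteq> lattice d" using U V lattice_mono[OF d] by auto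
  have g: "\<gamma> (\<lambda>v\<in>V. the (q (u + v))) = ?g (i + u)"
    if "\<And>v. v \<in> V \<Longrightarrow> q (u + v) = Some (y (i + (u + v)))" "i \<in> lattice d" "u \<in> lattice d" for q i u
  proof -
    have "(\<lambda>v\<in>V. the (q (u + v))) = (\<lambda>v\<in>V. y (i + u + v))"
      using that(1) by (intro restrict_ext) (simp add: add.assoc)
    then show ?thesis by (simp only: sliding_apply[OF add_in_lattice[OF that(2,3)]])
  qed
  \<comment> \<open>The pattern is read off from \<open>y\<close> around \<open>i\<close>. Its
    support stays in \<open>D\<close> because the window \<open>V\<close> only extends along
    \<open>lattice d'\<close>, under which \<open>D\<close> is invariant.\<close>
  have occ: "\<exists>q. occurs_at D y q i \<and> dom q = ?W W \<and> ran q \<subseteq> B \<and>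
      (\<forall>u\<in>W. \<forall>v\<in>V. q (u + v) = Some (y (i + (u + v))))"
    if i: "i \<in> lattice d" and W: "\<forall>u\<in>W. i + u \<in> D" for W i
  proof -
    define q where "q = (\<lambda>w. if w \<in> ?W W then Some (y (i + w)) else None)"
    have dq: "dom q = ?W W" by (auto simp: q_def split: if_splits)
    have iD: "i + w \<in> D" if wW: "w \<in> ?W W" for w
    proof -
      obtain u v where w: "w = u + v" "u \<in> W" "v \<in> V" using wW by auto
      show ?thesis using D(2)[OF W[rule_format, OF w(2)], of v] w V by (auto simp: add.assoc)
    qed
    have "y (i + w) \<in> B" if "w \<in> ?W W" for w
      using PiE_mem[OF y] iD[OF that] D(1) by blast
    then have "ran q \<subseteq> B" by (auto simp: ran_def q_def split: if_splits)
    moreover have "occurs_at D y q i"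
      unfolding occurs_at_def dq using iD by (simp add: q_def)
    moreover have "q (u + v) = Some (y (i + (u + v)))" if "u \<in> W" "v \<in> V" for u v
      using that by (force simp: q_def)
    ultimately show ?thesis using dq by blast
  qed
  have 1: "(\<exists>q\<in>?P1 p. occurs_at D y q i) \<longleftrightarrow> occurs_at D ?g p i" if p: "p \<in> F" and i: "i \<in> lattice d" for p i
  proof
    have dp: "dom p \<subseteq> lattice d" using F p by (auto simp: patterns_def)
    assume "\<exists>q\<in>?P1 p. occurs_at D y q i"
    then obtain q where q: "dom q = ?W (dom p)" "\<And>u. u \<in> dom p \<Longrightarrow> p u = Some (\<gamma> (\<lambda>v\<in>V. the (q (u + v))))"
      "occurs_at D y q i" by blast
    have "i + u \<in> D \<and> p u = Some (?g (i + u))" if u: "u \<in> dom p" for u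
    proof
      have uv: "u + v \<in> dom q" if "v \<in> V" for v using q(1) u that by force
      \<comment> \<open>The support of \<open>q\<close> contains \<open>u\<close> itself, since the
        origin lies in \<open>V\<close>.\<close>
      show "i + u \<in> D" using occurs_atD(1)[OF q(3) uv[OF V(2)]] by simp
      show "p u = Some (?g (i + u))"
        unfolding q(2)[OF u] using occurs_atD(2)[OF q(3) uv] u dp i by (subst g) auto
    qed
    then show "occurs_at D ?g p i" unfolding occurs_at_def by blast
  next
    have dp: "dom p \<subseteq> lattice d" using F p by (auto simp: patterns_def)
    assume o: "occurs_at D ?g p i"
    have "\<forall>u\<in>dom p. i + u \<in> D" using occurs_atD(1)[OF o] by blast
    from occ[OF i this] obtain q where q: "occurs_at D y q i" "dom q = ?W (dom p)" "ran q \<subseteq> B"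
        "\<forall>u\<in>dom p. \<forall>v\<in>V. q (u + v) = Some (y (i + (u + v)))"
      by (elim exE conjE)
    have pu: "p u = Some (\<gamma> (\<lambda>v\<in>V. the (q (u + v))))" if u: "u \<in> dom p" for u
      using g[of q u i, OF q(4)[rule_format, OF u] i subsetD[OF dp u]] occurs_atD(2)[OF o u] by simp
    show "\<exists>q\<in>?P1 p. occurs_at D y q i"
      by (intro bexI[of _ q] CollectI conjI ballI) (fact q(1), fact q(2), fact q(3), erule pu)
  qed
  have gg: "\<rho> (\<lambda>u\<in>U. \<gamma> (\<lambda>v\<in>V. the (q (u + v)))) = sliding d U \<rho> ?g i"
    if "\<And>u v. u \<in> U \<Longrightarrow> v \<in> V \<Longrightarrow> q (u + v) = Some (y (i + (u + v)))" "i \<in> lattice d" for q i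
  proof -
    have "(\<lambda>u\<in>U. \<gamma> (\<lambda>v\<in>V. the (q (u + v)))) = (\<lambda>u\<in>U. ?g (i + u))"
    proof (rule restrict_ext)
      fix u assume u: "u \<in> U"
      show "\<gamma> (\<lambda>v\<in>V. the (q (u + v))) = ?g (i + u)"
        by (rule g[of q u i, OF that(1)[OF u] that(2)]) (use u Ud in auto)
    qed
    then show ?thesis by (simp only: sliding_apply[OF that(2)])
  qed
  \<comment> \<open>The whole support of \<open>q\<close> lies in \<open>D\<close> exactly when
    \<open>i\<close> does: the origin is in the support, and the other positions differ from it by
    vectors of \<open>lattice d'\<close>.\<close>
  have 2: "(\<exists>q\<in>?P2. occurs_at D y q i) \<longleftrightarrow> i \<in> D \<and> sliding d U \<rho> ?g i \<noteq> y i" if i: "i \<in> lattice d" for i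
  proof
    assume "\<exists>q\<in>?P2. occurs_at D y q i"
    then obtain q where P2: "q \<in> ?P2" and q3: "occurs_at D y q i" by (elim bexE)
    from P2 have q: "dom q = ?W U" "the (q 0) \<noteq> \<rho> (\<lambda>u\<in>U. \<gamma> (\<lambda>v\<in>V. the (q (u + v))))"
      by simp_all
    have uv: "u + v \<in> dom q" if "u \<in> U" "v \<in> V" for u v using q(1) that by force
    have 0: "0 \<in> dom q" using uv[OF U(2) V(2)] by simp
    have "sliding d U \<rho> ?g i \<noteq> y i"
      using q(2) gg[of q i] occurs_atD(2)[OF q3 uv] occurs_atD(2)[OF q3 0] i by simp
    then show "i \<in> D \<and> sliding d U \<rho> ?g i \<noteq> y i"
      using occurs_atD(1)[OF q3 0] by simp
  next
    assume n: "i \<in> D \<and> sliding d U \<rho> ?g i \<noteq> y i"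
    have "\<forall>u\<in>U. i + u \<in> D" using n D(2)[of i] U(1) by auto
    from occ[OF i this] obtain q where q: "occurs_at D y q i" "dom q = ?W U" "ran q \<subseteq> B"
        "\<forall>u\<in>U. \<forall>v\<in>V. q (u + v) = Some (y (i + (u + v)))"
      by (elim exE conjE)
    have "q 0 = Some (y i)" using q(4)[rule_format, OF U(2) V(2)] by simp
    then have q0: "the (q 0) \<noteq> \<rho> (\<lambda>u\<in>U. \<gamma> (\<lambda>v\<in>V. the (q (u + v))))"
      using n gg[of q i] q(4) i by auto
    show "\<exists>q\<in>?P2. occurs_at D y q i"
      by (intro bexI[of _ q] CollectI conjI) (fact q(1), fact q(2), fact q(3), fact q0)
  qed
  have split: "(\<forall>q\<in>(\<Union>p\<in>F. P1 p) \<union> P2. \<forall>i\<in>L. \<not> Q q i) \<longleftrightarrow>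
      (\<forall>i\<in>L. (\<forall>p\<in>F. \<not> (\<exists>q\<in>P1 p. Q q i)) \<and> \<not> (\<exists>q\<in>P2. Q q i))"
    for P1 :: "'a pattern \<Rightarrow> 'b pattern set" and P2 and L :: "pos set" and Q by blast
  have join: "(\<forall>i\<in>L. (\<forall>p\<in>F. \<not> Q p i) \<and> (i \<in> D \<longrightarrow> E i)) \<longleftrightarrow>
      (\<forall>p\<in>F. \<forall>i\<in>L. \<not> Q p i) \<and> (\<forall>i\<in>D. E i)" if "D \<subseteq> L" for L Q E using that by blast
  have "?L \<longleftrightarrow> (\<forall>q\<in>recoded_patterns U \<rho> V \<gamma> B F. \<forall>i\<in>lattice d. \<not> occurs_at D y q i)"
    using y by (simp add: no_occurrence_def)
  also have "\<dots> \<longleftrightarrow> (\<forall>i\<in>lattice d. (\<forall>p\<in>F. \<not> (\<exists>q\<in>?P1 p. occurs_at D y q i)) \<and> \<not> (\<exists>q\<in>?P2. occurs_at D y q i))"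
    unfolding recoded_patterns_def by (rule split)
  also have "\<dots> \<longleftrightarrow> (\<forall>i\<in>lattice d. (\<forall>p\<in>F. \<not> occurs_at D ?g p i) \<and> (i \<in> D \<longrightarrow> sliding d U \<rho> ?g i = y i))"
  proof (intro ball_cong refl)
    fix i assume i: "i \<in> lattice d"
    show "((\<forall>p\<in>F. \<not> (\<exists>q\<in>?P1 p. occurs_at D y q i)) \<and> \<not> (\<exists>q\<in>?P2. occurs_at D y q i)) \<longleftrightarrow>
      (\<forall>p\<in>F. \<not> occurs_at D ?g p i) \<and> (i \<in> D \<longrightarrow> sliding d U \<rho> ?g i = y i)"
      by (simp only: 1[OF _ i] 2[OF i] de_Morgan_conj not_not imp_conv_disj cong: ball_cong)
  qed
  also have "\<dots> \<longleftrightarrow> (\<forall>p\<in>F. \<forall>i\<in>lattice d. \<not> occurs_at D ?g p i) \<and> ?R2"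
    by (rule join[OF D(1)])
  also have "\<dots> \<longleftrightarrow> ?R1 \<and> ?R2"
    by (simp only: no_occurrence_def mem_Collect_eq sliding_in_PiE[OF \<gamma>] simp_thms)
  finally show ?thesis .
qed

section \<open>The empty subshift\<close>

lemma realizable_SFT_empty_iff:
  assumes A: "finite A" and d: "d' \<le> d"
  shows "realizable_SFT \<phi> d d' A {} \<longleftrightarrow> (\<lambda>_. 1) \<sim> \<phi>"
proof
  assume "realizable_SFT \<phi> d d' A {}"
  then obtain F where F: "F \<subseteq> patterns d A" "SFT d A F = {}" "speed d d' A A F id \<sim> \<phi>"
    by (auto simp: realizable_SFT_def)
  let ?s = "speed d d' A A F id"
  \<comment> \<open>Adequacy at size 0 already demands a point of the SFT for each strip
    configuration, and there is none. So the strip system is empty, and the same width is adequate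
    at every size.\<close>
  have "no_occurrence d (strip d d' (?s 0)) A F = {}"
    using adequate_speed[OF full_morphism_id A F(1) d, of 0] F(2) by (auto simp: adequate_def)
  then have "adequate d d' A F id k (?s 0)" for k
    using adequate_speed[OF full_morphism_id A F(1) d, of 0] by (simp add: adequate_def)
  then have "?s k \<le> ?s 0" for k by (rule speed_le[OF full_morphism_id F(1) d])
  then have "?s \<prec> (\<lambda>_. 1)" by (intro growth_leI[where M = "?s 0"]) simp
  moreover have "(\<lambda>_. 1) \<prec> ?s"
    by (rule growth_leI[where M = 1]) (use speed_ge_1[OF full_morphism_id A F(1) d] in simp)
  ultimately show "(\<lambda>_. 1) \<sim> \<phi>"
    using F(3) growth_equiv_trans by (metis growth_equiv_def)
next
  assume \<phi>: "(\<lambda>_. 1) \<sim> \<phi>"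
  \<comment> \<open>The empty pattern occurs everywhere in every configuration, so all strips are
    empty and the width 1 is adequate. This works for an empty alphabet too.\<close>
  let ?F = "{Map.empty} :: 'a pattern set"
  have F: "?F \<subseteq> patterns d A" by (simp add: patterns_def)
  have none: "no_occurrence d D A ?F = {}" for D
    by (simp add: no_occurrence_def occurs_at_def) (use zero_in_lattice in blast)
  have adq: "adequate d d' A ?F id k 1" for k
    using rule_fits_id[OF d] by (auto simp: adequate_def none)
  have "speed d d' A A ?F id k = 1" for k
    by (rule antisym[OF speed_le[OF full_morphism_id F d adq] speed_ge_1[OF full_morphism_id A F d]])
  then have "speed d d' A A ?F id = (\<lambda>_. 1)" by (rule ext)
  then have "speed d d' A A ?F id \<sim> \<phi>" using \<phi> by (simp only:)
  moreover have "SA d' ` SFT d A ?F = {}" by (simp only: SFT_eq_no_occurrence none image_empty)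
  moreover have "finite ?F" by (rule finite.insertI[OF finite.emptyI])
  ultimately show "realizable_SFT \<phi> d d' A {}"
    unfolding realizable_SFT_def using F by (intro exI[of _ ?F] conjI)
qed

text \<open>Only an upper bound on the speed is required here, and the speed is at least 1. The
  converse uses an empty covering alphabet, because no morphism from a nonempty full shift exists
  when \<open>A\<close> is empty.\<close>

lemma realizable_sofic_empty_iff:
  assumes d: "d' \<le> d"
  shows "realizable_sofic \<phi> d d' A {} \<longleftrightarrow> (\<lambda>_. 1) \<prec> \<phi>"
proof
  assume "realizable_sofic \<phi> d d' A {}"
  then obtain C :: "nat set" and F \<pi> where C: "finite C" "F \<subseteq> patterns d C" "full_morphism d C A \<pi>"
    and s: "speed d d' C A F \<pi> \<prec> \<phi>"
    by (auto simp: realizable_sofic_def)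
  have "(\<lambda>_. 1) \<prec> speed d d' C A F \<pi>"
    by (rule growth_leI[where M = 1]) (use speed_ge_1[OF C(3,1,2) d] in simp)
  then show "(\<lambda>_. 1) \<prec> \<phi>" using s by (rule growth_le_trans)
next
  assume \<phi>: "(\<lambda>_. 1) \<prec> \<phi>"
  \<comment> \<open>Over the empty alphabet there are no configurations, so any function is a
    morphism.\<close>
  define \<pi> :: "(pos \<Rightarrow> nat) \<Rightarrow> (pos \<Rightarrow> 'a)" where "\<pi> = undefined"
  have e: "lattice d \<rightarrow>\<^sub>E {} = ({} :: (pos \<Rightarrow> nat) set)"
    by (rule equals0I, drule PiE_mem[OF _ zero_in_lattice]) simp
  have \<pi>: "full_morphism d {} A \<pi>"
    by (simp add: morphism_def continuous_map_def topspace_full_shift e)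
  have F: "{} \<subseteq> patterns d ({} :: nat set)" by simp
  have none: "no_occurrence d D {} {} = ({} :: (pos \<Rightarrow> nat) set)" for D
    by (simp add: no_occurrence_def e)
  have "rule_fits d d' 1 {} \<pi> {} undefined"
    by (simp add: rule_fits_def local_rule_def e)
  then have "adequate d d' {} {} \<pi> k 1" for k
    by (auto simp: adequate_def none)
  then have "speed d d' {} A {} \<pi> k \<le> 1" for k
    by (rule speed_le[OF \<pi> F d])
  then have "speed d d' {} A {} \<pi> \<prec> (\<lambda>_. 1)" by (intro growth_leI[where M = 1]) simp
  then have "speed d d' {} A {} \<pi> \<prec> \<phi>" using \<phi> by (rule growth_le_trans)
  moreover have "SA d' ` \<pi> ` SFT d {} {} = {}" by (simp only: SFT_eq_no_occurrence none image_empty)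
  ultimately show "realizable_sofic \<phi> d d' A {}"
    unfolding realizable_sofic_def using \<pi> F
    by (intro exI[of _ "{}"] exI[of _ \<pi>] conjI finite.emptyI)
qed

section \<open>The sofic case\<close>

lemma rule_fits_sliding_comp:
  assumes fit: "rule_fits d d' n A \<pi> W \<sigma>" and U: "finite U" "U \<subseteq> lattice d'" and d: "d' \<le> d"
  shows "\<exists>W' \<sigma>'. rule_fits d d' n A (sliding d U \<rho> \<circ> \<pi>) W' \<sigma>'"
proof (intro exI)
  let ?W = "(\<lambda>(u, w). u + w) ` (U \<times> W)"
  let ?\<sigma> = "\<lambda>z. \<rho> (\<lambda>u\<in>U. \<sigma> (\<lambda>w\<in>W. z (u + w)))"
  have W: "finite W" "W \<subseteq> lattice d" and Ud: "U \<subseteq> lattice d"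
    using fit U lattice_mono[OF d] by (auto simp: rule_fits_def local_rule_def)
  have \<sigma>: "\<pi> x i = \<sigma> (\<lambda>w\<in>W. x (i + w))" if "x \<in> lattice d \<rightarrow>\<^sub>E A" "i \<in> lattice d" for x i
    using fit that by (simp only: rule_fits_def local_rule_def)
  have "(sliding d U \<rho> \<circ> \<pi>) x i = ?\<sigma> (\<lambda>v\<in>?W. x (i + v))"
    if x: "x \<in> lattice d \<rightarrow>\<^sub>E A" and i: "i \<in> lattice d" for x i
  proof -
    have "\<pi> x (i + u) = \<sigma> (\<lambda>w\<in>W. (\<lambda>v\<in>?W. x (i + v)) (u + w))" if u: "u \<in> U" for u
    proof -
      have "i + u \<in> lattice d" using i u Ud by auto
      moreover have "(\<lambda>w\<in>W. x (i + u + w)) = (\<lambda>w\<in>W. (\<lambda>v\<in>?W. x (i + v)) (u + w))"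
        using u by (intro restrict_ext) (force simp: add.assoc)
      ultimately show ?thesis by (simp only: \<sigma>[OF x])
    qed
    then have "(\<lambda>u\<in>U. \<pi> x (i + u)) = (\<lambda>u\<in>U. \<sigma> (\<lambda>w\<in>W. (\<lambda>v\<in>?W. x (i + v)) (u + w)))"
      by (intro restrict_ext)
    then show ?thesis by (simp only: comp_apply sliding_apply[OF i])
  qed
  moreover have "finite ?W" "?W \<subseteq> lattice d" using U(1) W Ud by (auto simp: subset_iff)
  \<comment> \<open>The sum of \<open>i\<close> and a vector of \<open>U\<close> is again in
    \<open>lattice d'\<close>, where the old neighborhood \<open>W\<close> fits. Composition
    therefore needs no wider strip.\<close>
  moreover have "(+) i ` ?W \<subseteq> strip d d' n" if i: "i \<in> lattice d'" for i
  proof -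
    have "i + (u + w) \<in> strip d d' n" if "u \<in> U" "w \<in> W" for u w
    proof -
      have "i + u \<in> lattice d'" using i that U(2) by auto
      then have "(+) (i + u) ` W \<subseteq> strip d d' n" using fit by (simp only: rule_fits_def)
      then show ?thesis using that(2) by (auto simp: add.assoc)
    qed
    then show ?thesis by auto
  qed
  ultimately show "rule_fits d d' n A (sliding d U \<rho> \<circ> \<pi>) ?W ?\<sigma>"
    unfolding rule_fits_def local_rule_def by blast
qed

text \<open>The covering SFT is kept and only its factor map is changed, so the strip systems are
  the same before and after; a single inequality between the speeds suffices for
  \<open>\<prec>\<close>.\<close>

lemma realizable_sofic_conjugate:
  assumes d: "d' \<le> d" and \<Sigma>: "subshift d' A \<Sigma>" and \<Sigma>': "subshift d' B \<Sigma>'"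
    and conj: "conjugate d' A \<Sigma> B \<Sigma>'" and ne: "\<Sigma> \<noteq> {}"
    and real: "realizable_sofic \<phi> d d' A \<Sigma>"
  shows "realizable_sofic \<phi> d d' B \<Sigma>'"
proof -
  obtain f where f: "morphism d' A \<Sigma> B \<Sigma>' f" "bij_betw f \<Sigma> \<Sigma>'"
    using conj by (auto simp: conjugate_def)
  obtain C :: "nat set" and F \<pi> where C: "finite C" "finite F" "F \<subseteq> patterns d C" "full_morphism d C A \<pi>"
    and \<pi>\<Sigma>: "SA d' ` \<pi> ` SFT d C F = \<Sigma>" and s: "speed d d' C A F \<pi> \<prec> \<phi>"
    using real by (auto simp: realizable_sofic_def)
  obtain x0 where "x0 \<in> \<Sigma>" using ne by blast
  then have "f x0 0 \<in> B" using PiE_mem[OF morphism_image(2)[OF f(1) \<Sigma>] zero_in_lattice] by blast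
  then have "B \<noteq> {}" by blast
  then obtain U \<rho> where U: "finite U" "U \<subseteq> lattice d'" "range \<rho> \<subseteq> B"
    and f\<rho>: "\<And>x. x \<in> \<Sigma> \<Longrightarrow> f x = sliding d' U \<rho> x"
    using Curtis_Hedlund_Lyndon_total[OF \<Sigma> f(1)] by metis
  have Ud: "U \<subseteq> lattice d" using U(2) lattice_mono[OF d] by auto
  let ?\<pi> = "sliding d U \<rho> \<circ> \<pi>"
  have \<pi>': "full_morphism d C B ?\<pi>"
    by (rule morphism_comp[OF C(4) morphism_sliding[OF U(1) Ud U(3)] subshift_full_shift[OF C(1)]])
  have "SA d' (?\<pi> x) = f (SA d' (\<pi> x))" if "x \<in> SFT d C F" for x
  proof -
    have "SA d' (\<pi> x) \<in> \<Sigma>" using that unfolding \<pi>\<Sigma>[symmetric] by (intro imageI)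
    then show ?thesis by (simp only: comp_apply SA_sliding[OF U(2) d] f\<rho>)
  qed
  then have "SA d' ` ?\<pi> ` SFT d C F = f ` (SA d' ` \<pi> ` SFT d C F)"
    unfolding image_image by (rule image_cong[OF refl])
  then have "SA d' ` ?\<pi> ` SFT d C F = \<Sigma>'"
    using f(2) by (simp add: \<pi>\<Sigma> bij_betw_def)
  moreover obtain r where "\<forall>k n. adequate d d' C F \<pi> (k + r) n \<longrightarrow>
      (\<forall>x\<in>no_occurrence d (strip d d' n) C F.
        \<exists>y\<in>SFT d C F. \<forall>v\<in>cube d' k. \<forall>w\<in>U. \<pi> x (v + w) = \<pi> y (v + w))"
    using adequate_window[OF C(4,3) d U(1,2)] by (elim exE)
  note r = this[rule_format]
  \<comment> \<open>On the cube of size \<open>k\<close> the new map reads \<open>\<pi> x\<close>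
    only on the cube thickened by \<open>U\<close>, which is where \<open>r\<close> provides
    agreement.\<close>
  have "adequate d d' C F ?\<pi> k n" if n: "adequate d d' C F \<pi> (k + r) n" for k n
    unfolding adequate_def
  proof (intro conjI ballI)
    show "1 \<le> n" using n by (simp add: adequate_def)
    show "\<exists>U \<rho>. rule_fits d d' n C ?\<pi> U \<rho>"
      using n rule_fits_sliding_comp[OF _ U(1,2) d] unfolding adequate_def by metis
    fix x assume x: "x \<in> no_occurrence d (strip d d' n) C F"
    obtain y where y: "y \<in> SFT d C F" "\<forall>v\<in>cube d' k. \<forall>w\<in>U. \<pi> x (v + w) = \<pi> y (v + w)"
      using r[OF n x] by (elim bexE)
    have "?\<pi> x v = ?\<pi> y v" if v: "v \<in> cube d' k" for v
    proof -
      have "v \<in> lattice d" using lattice_mono[OF d cube_subset_lattice[OF v]] .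
      then show ?thesis 
        unfolding comp_apply by (intro sliding_cong) (simp_all add: y(2)[rule_format, OF v])
    qed
    then show "\<exists>y\<in>SFT d C F. \<forall>v\<in>cube d' k. ?\<pi> x v = ?\<pi> y v" using y(1) by blast
  qed
  then have "speed d d' C B F ?\<pi> k \<le> speed d d' C A F \<pi> (k + r)" for k
    by (rule speed_le[OF \<pi>' C(3) d]) (rule adequate_speed[OF C(4,1,3) d])
  then have "speed d d' C B F ?\<pi> \<prec> speed d d' C A F \<pi>"
    by (intro growth_leI[where M = 1]) simp
  then have "speed d d' C B F ?\<pi> \<prec> \<phi>" using s by (rule growth_le_trans)
  ultimately show ?thesis
    unfolding realizable_sofic_def using C(1-3) \<pi>' by blast
qed

section \<open>The SFT case\<close>

lemma realizable_SFT_conjugate: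
  assumes d: "d' \<le> d" and \<Sigma>: "subshift d' A \<Sigma>" and \<Sigma>': "subshift d' B \<Sigma>'"
    and conj: "conjugate d' A \<Sigma> B \<Sigma>'" and ne: "\<Sigma> \<noteq> {}"
    and real: "realizable_SFT \<phi> d d' A \<Sigma>"
  shows "realizable_SFT \<phi> d d' B \<Sigma>'"
proof -
  obtain f g where f: "morphism d' A \<Sigma> B \<Sigma>' f" and g: "morphism d' B \<Sigma>' A \<Sigma> g"
    and gf: "\<And>x. x \<in> \<Sigma> \<Longrightarrow> g (f x) = x" and fg: "\<And>y. y \<in> \<Sigma>' \<Longrightarrow> f (g y) = y"
    using conjugateE[OF \<Sigma> \<Sigma>' conj] by blast
  note f\<Sigma> = morphism_image(1)[OF f \<Sigma>] and g\<Sigma> = morphism_image(1)[OF g \<Sigma>']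
  obtain F where F: "finite F" "F \<subseteq> patterns d A"
    and F\<Sigma>: "SA d' ` SFT d A F = \<Sigma>" and s: "speed d d' A A F id \<sim> \<phi>"
    using real by (auto simp: realizable_SFT_def)
  have A: "finite A" and B: "finite B" using \<Sigma> \<Sigma>' by (auto simp: subshift_def)
  obtain x0 where x0: "x0 \<in> \<Sigma>" using ne by blast
  then have "f x0 0 \<in> B" "x0 0 \<in> A"
    using PiE_mem[OF morphism_image(2)[OF f \<Sigma>] zero_in_lattice] PiE_mem[OF subshift_PiE[OF \<Sigma>] zero_in_lattice]
    by blast+
  then have AB: "A \<noteq> {}" "B \<noteq> {}" by blast+
  obtain U \<rho> where U: "finite U" "U \<subseteq> lattice d'" "0 \<in> U" "range \<rho> \<subseteq> B"
    and f\<rho>: "\<And>x. x \<in> \<Sigma> \<Longrightarrow> f x = sliding d' U \<rho> x"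
    using Curtis_Hedlund_Lyndon_total[OF \<Sigma> f AB(2)] by metis
  obtain V \<gamma> where V: "finite V" "V \<subseteq> lattice d'" "0 \<in> V" "range \<gamma> \<subseteq> A"
    and g\<gamma>: "\<And>y. y \<in> \<Sigma>' \<Longrightarrow> g y = sliding d' V \<gamma> y"
    using Curtis_Hedlund_Lyndon_total[OF \<Sigma>' g AB(1)] by metis
  have Ud: "U \<subseteq> lattice d" and Vd: "V \<subseteq> lattice d" using U(2) V(2) lattice_mono[OF d] by auto
  let ?f = "sliding d U \<rho>" and ?g = "sliding d V \<gamma>"
  let ?F = "recoded_patterns U \<rho> V \<gamma> B F"
  let ?S = "strip d d'"
  have F': "finite ?F" "?F \<subseteq> patterns d B"
    by (rule finite_recoded_patterns[OF U(1) V(1) B F], rule recoded_patterns_subset[OF U(1) V(1) Ud Vd F(2)])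
  have SAf: "SA d' (?f x) = f (SA d' x)" if "SA d' x \<in> \<Sigma>" for x
    using f\<rho>[OF that] SA_sliding[OF U(2) d] by metis
  have SAg: "SA d' (?g y) = g (SA d' y)" if "SA d' y \<in> \<Sigma>'" for y
    using g\<gamma>[OF that] SA_sliding[OF V(2) d] by metis
  \<comment> \<open>The central slice of a point of the SFT belongs to \<Sigma>, where
    \<open>g\<close> inverts \<open>f\<close>.\<close>
  have slice0: "?g (?f x) 0 = x 0" if "x \<in> SFT d A F" for x
  proof -
    have x: "SA d' x \<in> \<Sigma>" using that F\<Sigma> by blast
    then have "SA d' (?g (?f x)) = SA d' x" using SAf SAg f\<Sigma> gf by metis
    then show ?thesis by (metis SA_apply zero_in_lattice)
  qed
  \<comment> \<open>Any position can be moved to the origin by a \<open>d\<close>-dimensional shift,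
    under which the SFT is invariant. So the identity on the central slice extends to all
    slices.\<close>
  have gf_shift: "?g (?f x) i = ?g (?f (shift d i x)) 0" if "i \<in> lattice d" for x i
    using that by (simp add: sliding_shift[OF Ud] sliding_shift[OF Vd] shift_apply)
  have gf_SFT: "?g (?f x) = x" if x: "x \<in> SFT d A F" for x
  proof
    fix i
    show "?g (?f x) i = x i"
    proof (cases "i \<in> lattice d")
      case True
      then show ?thesis
        using gf_shift[OF True, of x] slice0[OF SFT_shift[OF F(2) x True]] by (simp add: shift_apply)
    next
      case False
      then show ?thesis using PiE_arb[OF SFT_PiE[OF x] False] by (simp add: sliding_def)
    qed
  qed
  note rec = no_occurrence_recoded_iff[OF U(2,3) V(2,3,4) F(2) d]
  have SFT_rec: "y \<in> SFT d B ?F \<longleftrightarrow> ?g y \<in> SFT d A F \<and> (\<forall>i\<in>lattice d. ?f (?g y) i = y i)"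
    if "y \<in> lattice d \<rightarrow>\<^sub>E B" for y
    unfolding SFT_eq_no_occurrence using lattice_mono[OF d] that by (intro rec) auto
  have strip_rec: "y \<in> no_occurrence d (?S n) B ?F \<longleftrightarrow>
      ?g y \<in> no_occurrence d (?S n) A F \<and> (\<forall>i\<in>?S n. ?f (?g y) i = y i)"
    if "y \<in> lattice d \<rightarrow>\<^sub>E B" for y n
    using strip_subset_lattice strip_add_lattice_iff[OF d] that by (intro rec) auto
  have f_SFT: "?f x \<in> SFT d B ?F" if "x \<in> SFT d A F" for x
    unfolding SFT_rec[OF sliding_in_PiE[OF U(4)]] using gf_SFT[OF that] that by simp
  have g_SFT: "?g y \<in> SFT d A F" "?f (?g y) = y" if y: "y \<in> SFT d B ?F" for y
  proof -
    show "?g y \<in> SFT d A F" using SFT_rec[OF SFT_PiE[OF y]] y by blast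
    have "\<And>i. i \<in> lattice d \<Longrightarrow> ?f (?g y) i = y i" using SFT_rec[OF SFT_PiE[OF y]] y by blast
    then show "?f (?g y) = y" by (rule PiE_ext[OF sliding_in_PiE[OF U(4)] SFT_PiE[OF y]])
  qed
  have "SFT d B ?F = ?f ` SFT d A F"
    using f_SFT g_SFT by (metis (no_types, lifting) image_eqI image_subsetI subsetI subset_antisym)
  then have "SA d' ` SFT d B ?F = (\<lambda>x. SA d' (?f x)) ` SFT d A F" by (simp add: image_image)
  also have "\<dots> = (\<lambda>x. f (SA d' x)) ` SFT d A F"
    by (rule image_cong[OF refl]) (use SAf F\<Sigma> in blast)
  also have "\<dots> = f ` \<Sigma>" by (simp add: F\<Sigma>[symmetric] image_image)
  also have "\<dots> = \<Sigma>'" using f\<Sigma> g\<Sigma> fg by (metis image_eqI image_subsetI subsetI subset_antisym)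
  finally have SA': "SA d' ` SFT d B ?F = \<Sigma>'" .

  let ?s = "speed d d' A A F id" and ?s' = "speed d d' B B ?F id"
  have cl: "v \<in> lattice d" "v \<in> ?S n" if "v \<in> cube d' k" for v k n
    using lattice_mono[OF d cube_subset_lattice[OF that]] lattice_subset_strip[OF d cube_subset_lattice[OF that]] .
  obtain r where "\<forall>k n. adequate d d' A F id (k + r) n \<longrightarrow>
      (\<forall>x\<in>no_occurrence d (?S n) A F.
        \<exists>y\<in>SFT d A F. \<forall>v\<in>cube d' k. \<forall>w\<in>U. x (v + w) = y (v + w))"
    using adequate_window[OF full_morphism_id F(2) d U(1,2)] unfolding id_apply by (elim exE)
  note r = this[rule_format]
  \<comment> \<open>On the strip \<open>y\<close> equals the \<open>f\<close>-image of
    \<open>?g y\<close>, and \<open>?g y\<close> avoids \<open>F\<close> there. Replacing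
    \<open>?g y\<close> by a point \<open>x\<close> of the old SFT that agrees with it on the cube
    thickened by \<open>U\<close> gives the matching point \<open>?f x\<close>.\<close>
  have "adequate d d' B ?F id k n" if n: "adequate d d' A F id (k + r) n" for k n
    unfolding adequate_def
  proof (intro conjI ballI)
    show "1 \<le> n" using n by (simp add: adequate_def)
    show "\<exists>U \<rho>. rule_fits d d' n B id U \<rho>" using rule_fits_id[OF d] by blast
    fix y assume y: "y \<in> no_occurrence d (?S n) B ?F"
    then have gy: "?g y \<in> no_occurrence d (?S n) A F" and fgy: "\<And>i. i \<in> ?S n \<Longrightarrow> ?f (?g y) i = y i"
      using strip_rec[OF no_occurrence_PiE[OF y]] by blast+
    obtain x where x: "x \<in> SFT d A F" "\<forall>v\<in>cube d' k. \<forall>w\<in>U. ?g y (v + w) = x (v + w)"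
      using r[OF n gy] by (elim bexE)
    have "id y v = id (?f x) v" if v: "v \<in> cube d' k" for v
    proof -
      have "y v = ?f (?g y) v" using fgy[OF cl(2)[OF v]] by simp
      also have "\<dots> = ?f x v" 
        by (intro sliding_cong) (simp_all add: x(2)[rule_format, OF v] cl(1)[OF v])
      finally show ?thesis by simp
    qed
    then show "\<exists>z\<in>SFT d B ?F. \<forall>v\<in>cube d' k. id y v = id z v" using f_SFT[OF x(1)] by blast
  qed
  then have "?s' k \<le> ?s (k + r)" for k
    by (rule speed_le[OF full_morphism_id F'(2) d]) (rule adequate_speed[OF full_morphism_id A F(2) d])
  then have s's: "?s' \<prec> ?s" by (intro growth_leI[where M = 1]) simp

  \<comment> \<open>The window read by the composite of \<open>?f\<close> followed by
    \<open>?g\<close>.\<close>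
  let ?W = "(\<lambda>(v, u). v + u) ` (V \<times> U)"
  have W: "finite ?W" "?W \<subseteq> lattice d'" using U(1,2) V(1,2) by (auto simp: subset_iff)
  obtain r1 where "\<forall>k n. adequate d d' A F id (k + r1) n \<longrightarrow>
      (\<forall>x\<in>no_occurrence d (?S n) A F.
        \<exists>y\<in>SFT d A F. \<forall>v\<in>cube d' k. \<forall>w\<in>?W. x (v + w) = y (v + w))"
    using adequate_window[OF full_morphism_id F(2) d W] unfolding id_apply by (elim exE)
  note r1 = this[rule_format]
  obtain r2 where "\<forall>k n. adequate d d' B ?F id (k + r2) n \<longrightarrow>
      (\<forall>y\<in>no_occurrence d (?S n) B ?F.
        \<exists>z\<in>SFT d B ?F. \<forall>v\<in>cube d' k. \<forall>w\<in>V. y (v + w) = z (v + w))"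
    using adequate_window[OF full_morphism_id F'(2) d V(1,2)] unfolding id_apply by (elim exE)
  note r2 = this[rule_format]
  \<comment> \<open>The cube of size 1 is the origin alone; \<open>r1\<close> thickens it to the
    window \<open>?W\<close>. The resulting width \<open>N\<close> is a constant, independent of
    \<open>k\<close>.\<close>
  define N where "N = ?s (1 + r1)"
  \<comment> \<open>On a strip of width \<open>n + N\<close> every slice at distance at most \<open>n\<close> from the center locally looks
    like a point of \<open>\<Sigma>\<close>, so that recoding is invertible there.\<close>
  have gf_strip: "?g (?f x) j = x j" if x: "x \<in> no_occurrence d (?S (n + N)) A F" and j: "j \<in> ?S n" for x n j
  proof -
    have jl: "j \<in> lattice d" using strip_subset_lattice[OF j] .
    \<comment> \<open>Moving the slice of \<open>j\<close> to the centre leaves a margin of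
      \<open>N\<close> on each side.\<close>
    have xj: "shift d j x \<in> no_occurrence d (?S N) A F"
      by (rule no_occurrence_shift[OF F(2) x jl])
        (use strip_subset_lattice strip_add[OF j] in \<open>auto simp: add.commute\<close>)
    obtain z where z: "z \<in> SFT d A F"
      and zw: "\<forall>v\<in>cube d' 1. \<forall>w\<in>?W. shift d j x (v + w) = z (v + w)"
      using r1[OF adequate_speed[OF full_morphism_id A F(2) d] xj[unfolded N_def]] by (elim bexE)
    have eq: "shift d j x w = z w" if "w \<in> ?W" for w
      using zw[rule_format, OF zero_in_cube_1 that] by simp
    have "?f (shift d j x) v = ?f z v" if v: "v \<in> V" for v
      by (rule sliding_cong) (use v Vd eq in auto)
    \<comment> \<open>The shifted configuration agrees on \<open>?W\<close> with the SFT point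
      \<open>z\<close>, and the composite at the origin reads nothing else.\<close>
    then have "?g (?f (shift d j x)) 0 = ?g (?f z) 0"
      by (intro sliding_cong[of 0 d 0 V]) simp_all
    also have "\<dots> = z 0" by (rule slice0[OF z])
    also have "\<dots> = shift d j x 0" 
    proof -
      have "0 + 0 \<in> ?W" using U(3) V(3) by (intro image_eqI[of _ _ "(0, 0)"]) simp_all
      then show ?thesis using eq[of 0] by simp
    qed
    finally show ?thesis using gf_shift[OF jl] by (simp add: shift_apply)
  qed
  \<comment> \<open>The margin \<open>N\<close> is spent to make \<open>?f x\<close> avoid the
    recoded patterns on the strip of width \<open>n\<close>, including those of the second family.
    The point \<open>y\<close> matching \<open>?f x\<close> is then carried back by
    \<open>?g\<close>.\<close>
  have "adequate d d' A F id k (n + N)" if n: "adequate d d' B ?F id (k + r2) n" for k n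
    unfolding adequate_def
  proof (intro conjI ballI)
    show "1 \<le> n + N" using n by (simp add: adequate_def)
    show "\<exists>U \<rho>. rule_fits d d' (n + N) A id U \<rho>" using rule_fits_id[OF d] by blast
    fix x assume x: "x \<in> no_occurrence d (?S (n + N)) A F"
    have "?S n \<subseteq> ?S (n + N)" using strip_mono[of n "n + N"] by auto
    then have xn: "x \<in> no_occurrence d (?S n) A F" using no_occurrence_antimono x by blast
    have "?g (?f x) \<in> no_occurrence d (?S n) A F"
      using no_occurrence_cong[OF sliding_in_PiE[OF V(4)] _ xn] gf_strip[OF x] by metis
    moreover have "?f (?g (?f x)) i = ?f x i" if i: "i \<in> ?S n" for i
    proof (rule sliding_cong)
      show "?g (?f x) (i + u) = x (i + u)" if "u \<in> U" for u
        using gf_strip[OF x] strip_add_lattice_iff[OF d] i that U(2) by blast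
    qed (use strip_subset_lattice[OF i] in auto)
    ultimately have "?f x \<in> no_occurrence d (?S n) B ?F"
      using strip_rec[OF sliding_in_PiE[OF U(4)]] by blast
    from r2[OF n this] obtain y where y: "y \<in> SFT d B ?F" "\<forall>v\<in>cube d' k. \<forall>w\<in>V. ?f x (v + w) = y (v + w)"
      by (elim bexE)
    have "id x v = id (?g y) v" if v: "v \<in> cube d' k" for v
    proof -
      have "x v = ?g (?f x) v" using gf_strip[OF x cl(2)[OF v]] by simp
      also have "\<dots> = ?g y v" 
        by (intro sliding_cong) (simp_all add: y(2)[rule_format, OF v] cl(1)[OF v])
      finally show ?thesis by simp
    qed
    then show "\<exists>z\<in>SFT d A F. \<forall>v\<in>cube d' k. id x v = id z v" using g_SFT(1)[OF y(1)] by blast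
  qed
  then have le: "?s k \<le> ?s' (k + r2) + N" for k
    by (rule speed_le[OF full_morphism_id F(2) d]) (rule adequate_speed[OF full_morphism_id B F'(2) d])
  \<comment> \<open>The speed \<open>?s'\<close> is at least 1, so the additive constant
    \<open>N\<close> is absorbed into a multiplicative one, as \<open>\<prec>\<close>
    requires.\<close>
  have "?s k \<le> (1 + N) * ?s' (k + r2)" for k
    using le[of k] mult_le_mono2[OF speed_ge_1[OF full_morphism_id B F'(2) d, of "k + r2"], of N]
    unfolding add_mult_distrib by linarith
  then have "?s \<prec> ?s'" by (rule growth_leI)
  then have "?s' \<sim> ?s" using s's by (simp add: growth_equiv_def)
  then have "?s' \<sim> \<phi>" using s by (rule growth_equiv_trans)
  then show ?thesis unfolding realizable_SFT_def using F' SA' by blast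
qed

section \<open>Both equivalences\<close>

theorem proposition3p3:
  fixes d d' :: nat and A :: "'a set" and B :: "'b set"
    and \<Sigma> :: "(pos \<Rightarrow> 'a) set" and \<Sigma>' :: "(pos \<Rightarrow> 'b) set"
    and \<phi> :: "nat \<Rightarrow> nat"
  assumes "1 \<le> d'" and "d' < d"
    and "subshift d' A \<Sigma>" and "subshift d' B \<Sigma>'"
    and "conjugate d' A \<Sigma> B \<Sigma>'"
    and "mono \<phi>"
  shows "(realizable_SFT \<phi> d d' A \<Sigma> \<longleftrightarrow> realizable_SFT \<phi> d d' B \<Sigma>')
    \<and> (realizable_sofic \<phi> d d' A \<Sigma> \<longleftrightarrow> realizable_sofic \<phi> d d' B \<Sigma>')"
proof (cases "\<Sigma> = {}")
  \<comment> \<open>Both subshifts are then empty, and the criteria for realizing the empty subshift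
    depend on \<phi> alone and not on the alphabet.\<close>
  case True
  then have "\<Sigma>' = {}" using assms(5) by (auto simp: conjugate_def bij_betw_def)
  moreover have "finite A" "finite B" using assms(3,4) by (auto simp: subshift_def)
  ultimately show ?thesis
    using True assms(2) by (simp add: realizable_SFT_empty_iff realizable_sofic_empty_iff)
next
  case False
  have d: "d' \<le> d" using assms(2) by simp
  have "\<Sigma>' \<noteq> {}" using False assms(5) by (auto simp: conjugate_def bij_betw_def)
  \<comment> \<open>The inverse conjugacy supplies the two converse implications.\<close>
  note ne = False this and conj = assms(5) conjugate_sym[OF assms(3-5)]
  show ?thesis
    using realizable_SFT_conjugate[OF d assms(3,4) conj(1) ne(1)]
      realizable_SFT_conjugate[OF d assms(4,3) conj(2) ne(2)]
      realizable_sofic_conjugate[OF d assms(3,4) conj(1) ne(1)]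
      realizable_sofic_conjugate[OF d assms(4,3) conj(2) ne(2)]
    by blast
qed

end
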